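(* Let $p_1,\dots,p_m$ be independent $p$-values with set of true nulls $\mathcal H_0\subset\{1,\dots,m\}$, such that $p_i\sim U(0,1)$ for $i\in\mathcal H_0$. For $\alpha\in(0,1)$ let $\hat k_\alpha$ be the number of rejections of the Benjamini–Hochberg (BH) procedure at level $\alpha$ and $R_{\hat k_\alpha}$ its rejection set. Let $\delta\in(0,1)$, $\kappa=\pi^2/6$. For any $\alpha\in(0,1)$, each of the following quantities is a $(1-\delta)$-confidence upper bound for $\mathrm{FDP}(R_{\hat k_\alpha})$ (i.e. $\mathbf P(\mathrm{FDP}(R_{\hat k_\alpha})\le \overline{\mathrm{FDP}}_\alpha)\ge 1-\delta$), where the KR bound requires in addition $\delta\le 0.31$: $$\overline{\mathrm{FDP}}^{\mathrm{Simes}}_\alpha=\mathbf 1\{\hat k_\alpha\ge1\}\wedge(\alpha/\delta),$$ $$\overline{\mathrm{FDP}}^{\mathrm{DKW}}_\alpha=\mathbf 1\{\hat k_\alpha\ge1\}\wedge\left(\alpha+\frac{m^{1/2}\sqrt{0.5\log(1/\delta)}}{1\vee\hat k_\alpha}\right),$$ $$\overline{\mathrm{FDP}}^{\mathrm{KR}}_\alpha=\mathbf 1\{\hat k_\alpha\ge1\}\wedge\left(\frac{\log(1/\delta)}{\log(1+\log(1/\delta))}\Bigl(\alpha+\frac1{1\vee\hat k_\alpha}\Bigr)\right),$$ $$\overline{\mathrm{FDP}}^{\mathrm{Well}}_\alpha=\mathbf 1\{\hat k_\alpha\ge1\}\wedge\left(\alpha\,h^{-1}\!\left(\frac{2\log(\kappa/\delta)+4\log\Bigl(1+\log_2\bigl(\tfrac{m}{\alpha(1\vee\hat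 k_\alpha)}\bigr)\Bigr)}{\alpha(1\vee\hat k_\alpha)}\right)\right).$$ Moreover these bounds are valid uniformly in $\alpha$: for each $\mathrm{Method}\in\{\mathrm{Simes},\mathrm{DKW},\mathrm{KR},\mathrm{Well}\}$ (with $\delta\le0.31$ for KR), $$\mathbf P\bigl(\forall\alpha\in(0,1),\ \mathrm{FDP}(R_{\hat k_\alpha})\le\overline{\mathrm{FDP}}^{\mathrm{Method}}_\alpha\bigr)\ge1-\delta,$$ and thus they are also valid for a data-dependent choice $\alpha=\hat\alpha$.
   Context: Top-$k$ setting: $p_1,\dots,p_m\in[0,1]$ are independent, $\mathcal H_0$ is a fixed subset of $\{1,\dots,m\}$ of cardinality $m_0$, $0<m_0<m$, and nothing is assumed on the marginals of $p_i$, $i\notin\mathcal H_0$. $p_{(1)}\le\dots\le p_{(m)}$ are the ordered $p$-values; $R_k=\{i: p_i\le p_{(k)}\}$ for $1\le k\le m$ and $R_0=\emptyset$. The BH procedure at level $\alpha$ rejects $R_{\hat k_\alpha}$ with $\hat k_\alpha=\max\{k\in\{1,\dots,m\}: m p_{(k)}/k\le\alpha\}$, and $\hat k_\alpha=0$ if this set is empty. $\mathrm{FDP}(R)=|R\cap\mathcal H_0|/(|R|\vee1)$. The function $h(\lambda)=\lambda(\log\lambda-1)+1$, $\lambda>1$, is an increasing bijection from $(1,\infty)$ onto $(0,\infty)$ with inverse $h^{-1}$. *)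

theory Defs
  imports "HOL-Probability.Probability"
begin

text \<open>A vector of p-values is a function \<open>p :: nat \<Rightarrow> real\<close>, of which only the values at \<open>1, \<dots>, m\<close> matter.
  Logarithms are natural unless the base is given.\<close>

definition ordered_pvalue :: "nat \<Rightarrow> (nat \<Rightarrow> real) \<Rightarrow> nat \<Rightarrow> real" where
  "ordered_pvalue m p k = sort (map p [1..<Suc m]) ! (k - 1)" \<comment> \<open>meaningful for \<open>1 \<le> k \<le> m\<close>\<close>

definition rejection_set :: "nat \<Rightarrow> (nat \<Rightarrow> real) \<Rightarrow> nat \<Rightarrow> nat set" where
  "rejection_set m p k = (if k = 0 then {} else {i \<in> {1..m}. p i \<le> ordered_pvalue m p k})"

definition BH_count :: "nat \<Rightarrow> real \<Rightarrow> (nat \<Rightarrow> real) \<Rightarrow> nat" where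
  "BH_count m \<alpha> p =
     (let K = {k \<in> {1..m}. real m * ordered_pvalue m p k / real k \<le> \<alpha>}
      in if K = {} then 0 else Max K)"

definition FDP :: "nat set \<Rightarrow> nat set \<Rightarrow> real" where
  "FDP H0 R = real (card (R \<inter> H0)) / real (max (card R) 1)"

definition h :: "real \<Rightarrow> real" where
  "h x = x * (ln x - 1) + 1"

text \<open>Inverse of the bijection \<open>h\<close> from \<open>{1<..}\<close> onto \<open>{0<..}\<close>; unspecified at nonpositive arguments,
  which do not occur below when \<open>k \<le> m\<close> and \<open>\<alpha>, \<delta> \<in> {0<..<1}\<close>.\<close>

definition h_inv :: "real \<Rightarrow> real" where
  "h_inv = inv_into {1<..} h"

datatype bound_method = Simes | DKW | KR | Well

primrec raw_bound :: "bound_method \<Rightarrow> nat \<Rightarrow> real \<Rightarrow> real \<Rightarrow> nat \<Rightarrow> real" where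
  "raw_bound Simes m \<delta> \<alpha> k = \<alpha> / \<delta>"
| "raw_bound DKW m \<delta> \<alpha> k = \<alpha> + sqrt (real m) * sqrt (1 / 2 * ln (1 / \<delta>)) / real (max 1 k)"
| "raw_bound KR m \<delta> \<alpha> k = ln (1 / \<delta>) / ln (1 + ln (1 / \<delta>)) * (\<alpha> + 1 / real (max 1 k))"
| "raw_bound Well m \<delta> \<alpha> k =
     \<alpha> * h_inv ((2 * ln (pi\<^sup>2 / 6 / \<delta>) + 4 * ln (1 + log 2 (real m / (\<alpha> * real (max 1 k)))))
                / (\<alpha> * real (max 1 k)))"

definition FDP_bound :: "bound_method \<Rightarrow> nat \<Rightarrow> real \<Rightarrow> real \<Rightarrow> nat \<Rightarrow> real" where
  "FDP_bound meth m \<delta> \<alpha> k = min (of_bool (k \<ge> 1)) (raw_bound meth m \<delta> \<alpha> k)"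

definition BH_covered :: "bound_method \<Rightarrow> nat \<Rightarrow> nat set \<Rightarrow> real \<Rightarrow> real \<Rightarrow> (nat \<Rightarrow> real) \<Rightarrow> bool" where
  "BH_covered meth m H0 \<delta> \<alpha> p \<longleftrightarrow>
     FDP H0 (rejection_set m p (BH_count m \<alpha> p)) \<le> FDP_bound meth m \<delta> \<alpha> (BH_count m \<alpha> p)"

end

theory Submission imports Defs begin

text \<open>Every null p-value rejected by BH at level \<open>\<alpha>\<close> with \<open>k\<close> rejections is at most \<open>t = \<alpha> k / m\<close>, so each bound says
  that the number \<open>N t\<close> of null p-values below \<open>t\<close> stays under a curve, simultaneously in \<open>t\<close>; for Simes, DKW
  and KR the curve is a line, for Well it is dominated on dyadic blocks by lines through the origin. Run \<open>t\<close> from \<open>1\<close>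
  down to \<open>0\<close>: \<open>N\<close> is then a pure death process, an upward line is crossed exactly at lattice points, and a crossing
  has probability at most the initial value of any positive supermartingale that is at least \<open>1\<close> on the line. The
  martingales are \<open>N t / t\<close> (Simes) and \<open>(1 + \<gamma> / t) ^ N t\<close> with tuned \<open>\<gamma>\<close> (KR, and Wellner's inequality on each block). DKW with
  the sharp constant and no restriction on \<open>\<delta>\<close> comes from the supermartingale
  \<open>exp (- 6 A ((3 m t + A) / (N t + 2 m t) - 1))\<close>, where \<open>A\<close> is the intercept of the line.\<close>

section \<open>Analytic estimates\<close>

lemma DERIV_nonneg_mono:
  fixes f :: "real \<Rightarrow> real"
  assumes "a \<le> b" "\<And>x. a \<le> x \<Longrightarrow> x \<le> b \<Longrightarrow> (f has_real_derivative f' x) (at x)"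
    "\<And>x. a \<le> x \<Longrightarrow> x \<le> b \<Longrightarrow> 0 \<le> f' x"
  shows "f a \<le> f b"
proof (rule DERIV_nonneg_imp_nondecreasing[OF assms(1), where f = f])
  fix x assume "a \<le> x" "x \<le> b"
  then have "(f has_real_derivative f' x) (at x) \<and> 0 \<le> f' x" using assms by blast
  then show "\<exists>y. (f has_real_derivative y) (at x) \<and> 0 \<le> y" ..
qed

text \<open>This is the generator inequality of the DKW supermartingale in normalised variables.
  Multiplying the right-hand side by \<open>exp (9 * q * u + 6 * q\<^sup>2)\<close> gives a function
  \<open>W\<close> of \<open>q\<close> that equals 1 at 0 and is nondecreasing.\<close>

lemma dkw_exp_bound:
  fixes q u :: real
  assumes "0 \<le> q" "0 \<le> u" "u < 1"
  shows "exp (- (9 * q * u + 6 * q\<^sup>2)) \<le> 1 - 9 * q * u + 6 * q\<^sup>2 * u / (1 - u)"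
proof -
  define c where "c = 1 / (1 - u)"
  have c: "0 \<le> c" "c * u = c - 1" using assms by (auto simp: c_def field_simps)
  define W where "W x = (1 - 9 * x * u + 6 * x\<^sup>2 * (c * u)) * exp (9 * x * u + 6 * x\<^sup>2)" for x
  define W' where "W' x = 3 * x * c * ((3 * u - 2)\<^sup>2 * (3 * u + 1) + 18 * x * u * (3 * u - 2) + 24 * u * x\<^sup>2)
    * exp (9 * x * u + 6 * x\<^sup>2)" for x
  have "(W has_real_derivative W' x) (at x)" for x
  proof -
    have "(W has_real_derivative ((- 9 * u + 12 * x * (c * u)) +
        (1 - 9 * x * u + 6 * x\<^sup>2 * (c * u)) * (9 * u + 12 * x)) * exp (9 * x * u + 6 * x\<^sup>2)) (at x)"
      unfolding W_def by (auto intro!: derivative_eq_intros simp: algebra_simps)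
    moreover have "(- 9 * u + 12 * x * (c * u)) + (1 - 9 * x * u + 6 * x\<^sup>2 * (c * u)) * (9 * u + 12 * x)
        = 3 * x * c * ((3 * u - 2)\<^sup>2 * (3 * u + 1) + 18 * x * u * (3 * u - 2) + 24 * u * x\<^sup>2)"
      using c(2) by algebra
    ultimately show ?thesis unfolding W'_def by simp
  qed
  moreover have "0 \<le> W' x" if "0 \<le> x" for x
  proof -
    \<comment> \<open>The nontrivial factor of \<open>W'\<close> is a quadratic in \<open>x\<close>,
      nonnegative by completing the square; \<open>u < 1\<close> keeps the leftover coefficient
      \<open>1 - 3 * u / 8\<close> positive.\<close>
    define r where "r = 3 * u - 2"
    have "r\<^sup>2 * (3 * u + 1) + 18 * x * u * r + 24 * u * x\<^sup>2
        = r\<^sup>2 * (1 - 3 * u / 8) + 24 * u * (x + 3 * r / 8)\<^sup>2"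
      by (simp add: field_simps power2_eq_square)
    also have "\<dots> \<ge> 0"
      using assms by (intro add_nonneg_nonneg mult_nonneg_nonneg) auto
    finally show ?thesis
      using c(1) that unfolding W'_def r_def by simp
  qed
  ultimately have "W 0 \<le> W q"
    by (rule DERIV_nonneg_mono[OF \<open>0 \<le> q\<close>])
  then have "1 * exp (- (9 * q * u + 6 * q\<^sup>2)) \<le> W q * exp (- (9 * q * u + 6 * q\<^sup>2))"
    by (intro mult_right_mono) (simp_all add: W_def)
  also have "\<dots> = 1 - 9 * q * u + 6 * q\<^sup>2 * (c * u)"
    unfolding W_def mult.assoc mult_exp_exp by simp
  finally show ?thesis by (simp add: c_def)
qed

text \<open>Obtained by integrating \<open>ln (1 + y) \<ge> y / (1 + y)\<close> from 0. It is the
  monotonicity input for the KR rate.\<close>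

lemma ln_one_plus_lower:
  fixes x :: real
  assumes "0 \<le> x"
  shows "2 * x \<le> (2 + x) * ln (1 + x)"
proof -
  define F where "F = (\<lambda>x::real. (2 + x) * ln (1 + x) - 2 * x)"
  have "F 0 \<le> F x"
  proof (rule DERIV_nonneg_mono[OF assms, where f = F and f' = "\<lambda>x. ln (1 + x) - x / (1 + x)"])
    fix y :: real assume y: "0 \<le> y"
    show "(F has_real_derivative ln (1 + y) - y / (1 + y)) (at y)"
    proof -
      have "(F has_real_derivative ln (1 + y) + (2 + y) / (1 + y) - 2) (at y)"
        unfolding F_def using y by (auto intro!: derivative_eq_intros)
      also have "ln (1 + y) + (2 + y) / (1 + y) - 2 = ln (1 + y) - y / (1 + y)"
        using y by (simp add: divide_simps)
      finally show ?thesis .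
    qed
    have "ln (1 / (1 + y)) \<le> 1 / (1 + y) - 1" using y by (intro ln_le_minus_one) auto
    then show "0 \<le> ln (1 + y) - y / (1 + y)" using y by (simp add: ln_div field_simps)
  qed
  then show ?thesis by (simp add: F_def)
qed

text \<open>The Poisson large-deviation exponent of the line \<open>u \<mapsto> C (1 + u)\<close>, minimised over the crossing position \<open>u\<close>.\<close>

lemma kr_rate_min:
  fixes v g u :: real
  assumes v: "0 < v" and u: "0 < u" and g: "g = v\<^sup>2 / ((1 + v) * ln (1 + v) - v)"
  shows "(1 + g / v) * ln (1 + v) \<le> (1 + u) * ln (1 + g / u)"
proof -
  \<comment> \<open>\<open>e x\<close> is \<open>h (1 + x)\<close>. The derivative of
    \<open>Q\<close> has the sign of \<open>2 * x - (2 + x) * ln (1 + x)\<close>, so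
    \<open>Q\<close> decreases; the constant \<open>g\<close> is \<open>1 / Q v\<close>.\<close>
  define e where "e x = (1 + x) * ln (1 + x) - x" for x :: real
  define Q where "Q x = e x / x\<^sup>2" for x
  have e_pos: "0 < e x" if "0 < x" for x
  proof -
    have "2 * ((1 + x) * ln (1 + x) - x) \<ge> x * ln (1 + x)"
      using that ln_one_plus_lower[of x] by (simp add: algebra_simps)
    moreover have "0 < x * ln (1 + x)" using that by simp
    ultimately show ?thesis by (simp add: e_def)
  qed
  have Q_mono: "Q b \<le> Q a" if "0 < a" "a \<le> b" for a b
  proof -
    have "- Q a \<le> - Q b"
    proof (rule DERIV_nonneg_mono[OF that(2), where f = "\<lambda>x. - Q x" and f' = "\<lambda>x. ((2 + x) * ln (1 + x) - 2 * x) / x ^ 3"])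
      fix x assume x: "a \<le> x"
      show "((\<lambda>x. - Q x) has_real_derivative ((2 + x) * ln (1 + x) - 2 * x) / x ^ 3) (at x)"
      proof -
        have "((\<lambda>x. - Q x) has_real_derivative
            - ((ln (1 + x) * x\<^sup>2 - e x * (2 * x)) / (x\<^sup>2 * x\<^sup>2))) (at x)"
          unfolding Q_def e_def using x that
          by (auto intro!: derivative_eq_intros)
        also have "- ((ln (1 + x) * x\<^sup>2 - e x * (2 * x)) / (x\<^sup>2 * x\<^sup>2))
            = ((2 + x) * ln (1 + x) - 2 * x) / x ^ 3"
          using x that by (simp add: e_def divide_simps) (simp add: algebra_simps eval_nat_numeral)
        finally show ?thesis .
      qed
      show "0 \<le> ((2 + x) * ln (1 + x) - 2 * x) / x ^ 3"
        using x that ln_one_plus_lower[of x] by simp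
    qed
    then show ?thesis by simp
  qed
  have g_eq: "g = v\<^sup>2 / e v" by (simp add: g e_def)
  have gpos: "0 < g" and gQ: "g * Q v = 1"
    using v e_pos[OF v] by (simp_all add: g_eq Q_def)
  \<comment> \<open>The substitution \<open>x = g / u\<close> turns the right-hand side into
    \<open>J x\<close>. The sign of \<open>J' x\<close> is that of \<open>1 - g * Q x\<close>, which
    is nondecreasing and vanishes at \<open>v\<close>, so \<open>J\<close> is minimal there.\<close>
  define J where "J x = (1 + g / x) * ln (1 + x)" for x
  define J' where "J' x = (1 - g * Q x) / (1 + x)" for x
  have J: "(J has_real_derivative J' x) (at x)" if "0 < x" for x
  proof -
    have "(J has_real_derivative - (g / x\<^sup>2) * ln (1 + x) + (1 + g / x) / (1 + x)) (at x)"
      unfolding J_def using that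
      by (auto intro!: derivative_eq_intros simp: power2_eq_square)
    also have "- (g / x\<^sup>2) * ln (1 + x) + (1 + g / x) / (1 + x) = J' x"
      using that by (simp add: J'_def Q_def e_def divide_simps) (simp add: algebra_simps power2_eq_square)
    finally show ?thesis .
  qed
  have "J v \<le> J x" if x: "0 < x" for x
  proof (cases "v \<le> x")
    case True
    show ?thesis
    proof (rule DERIV_nonneg_mono[OF True, where f = J and f' = J'])
      fix y assume y: "v \<le> y"
      then show "(J has_real_derivative J' y) (at y)" using J[of y] v by simp
      have "g * Q y \<le> g * Q v" using y v gpos by (intro mult_left_mono Q_mono) auto
      then show "0 \<le> J' y" using gQ y v unfolding J'_def by simp
    qed
  next
    case False
    have "- J x \<le> - J v"
    proof (rule DERIV_nonneg_mono[where f = "\<lambda>x. - J x" and f' = "\<lambda>y. - J' y"])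
      show "x \<le> v" using False by simp
      fix y assume y: "x \<le> y" "y \<le> v"
      then show "((\<lambda>x. - J x) has_real_derivative - J' y) (at y)"
        using J[of y] x by (intro DERIV_minus) auto
      have "g * Q v \<le> g * Q y" using y x gpos by (intro mult_left_mono Q_mono) auto
      then have "J' y \<le> 0" using gQ y x unfolding J'_def by (simp add: divide_nonpos_pos)
      then show "0 \<le> - J' y" by simp
    qed
    then show ?thesis by simp
  qed
  from this[of "g / u"] show ?thesis
    using u gpos by (simp add: J_def)
qed

section \<open>The function \<open>h\<close> and its inverse\<close>

lemma h_deriv: "0 < x \<Longrightarrow> (h has_real_derivative ln x) (at x)"
  unfolding h_def by (auto intro!: derivative_eq_intros)

lemma h_isCont: "0 < x \<Longrightarrow> isCont h x"
  using h_deriv by (rule DERIV_isCont)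

lemma h_strict_mono:
  assumes "1 \<le> x" "x < y" shows "h x < h y"
proof (rule DERIV_pos_imp_increasing_open[OF assms(2), where f = h])
  fix z assume "x < z" "z < y"
  then have "1 < z" using assms by simp
  then have "(h has_real_derivative ln z) (at z) \<and> 0 < ln z"
    using h_deriv[of z] by simp
  then show "\<exists>d. (h has_real_derivative d) (at z) \<and> 0 < d" ..
next
  show "continuous_on {x..y} h"
    using assms by (auto intro!: continuous_at_imp_continuous_on h_isCont)
qed

lemma h_surj:
  assumes "0 < y" shows "\<exists>x>1. h x = y"
proof -
  \<comment> \<open>At this point \<open>ln b - 1 = y\<close>, so \<open>h b = y * b + 1\<close>
    exceeds \<open>y\<close>, while \<open>h 1 = 0\<close>.\<close>
  define b where "b = exp (1 + y)"
  have b: "1 < b" using assms by (simp add: b_def)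
  have "h b = y * b + 1" by (simp add: h_def b_def)
  moreover have "y * 1 \<le> y * b" using assms b by (intro mult_left_mono) auto
  ultimately have "y \<le> h b" by simp
  moreover have "h 1 = 0" by (simp add: h_def)
  moreover have "\<forall>x. 1 \<le> x \<and> x \<le> b \<longrightarrow> isCont h x"
    using h_isCont by simp
  ultimately obtain x where "1 \<le> x" "h x = y"
    using IVT[of h 1 y b] assms b by auto
  moreover have "x \<noteq> 1" using \<open>h x = y\<close> \<open>h 1 = 0\<close> assms by auto
  ultimately have "1 < x \<and> h x = y" by simp
  then show ?thesis ..
qed

lemma
  assumes "0 < y"
  shows h_inv_gt_1: "1 < h_inv y" and h_h_inv: "h (h_inv y) = y"
proof -
  have "y \<in> h ` {1<..}" using h_surj[OF assms] by auto
  from inv_into_into[OF this] f_inv_into_f[OF this] show "1 < h_inv y" "h (h_inv y) = y"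
    unfolding h_inv_def by simp_all
qed

lemma h_inv_mono:
  assumes "0 < x" "x \<le> y" shows "h_inv x \<le> h_inv y"
proof (rule ccontr)
  assume "\<not> h_inv x \<le> h_inv y"
  then have "h (h_inv y) < h (h_inv x)"
    using assms h_inv_gt_1[of y] by (intro h_strict_mono) auto
  then show False using assms by (simp add: h_h_inv)
qed

text \<open>Used to pass from rational levels to all levels, and for measurability of the Well bound
  at a random level.\<close>

lemma isCont_h_inv:
  assumes "0 < y" shows "isCont h_inv y"
proof -
  define x where "x = h_inv y"
  have x: "1 < x" "h x = y" using assms by (simp_all add: x_def h_inv_gt_1 h_h_inv)
  have "h_inv (h z) = z" if "1 < z" for z
  proof -
    have "inj_on h {1<..}"
      by (rule strict_mono_on_imp_inj_on) (auto simp: strict_mono_on_def intro: h_strict_mono)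
    then show ?thesis using that by (simp add: h_inv_def)
  qed
  \<comment> \<open>The left endpoint \<open>(1 + x) / 2\<close> keeps the neighbourhood of
    \<open>x\<close> inside \<open>{1<..}\<close>, where \<open>h\<close> is inverted by
    \<open>h_inv\<close>.\<close>
  moreover have "(1 + x) / 2 < x" "x < x + 1" using x by auto
  ultimately have "isCont h_inv (h x)"
    using x by (intro isCont_inverse_function2[where a = "(1 + x) / 2" and b = "x + 1" and f = h and g = h_inv])
      (auto intro!: h_isCont)
  then show ?thesis using x by simp
qed

text \<open>Concavity of \<open>ln (1 + y)\<close>, which vanishes at \<open>y = 0\<close>. With
  \<open>w = s / t\<close> it lets a parameter tuned at \<open>t = s\<close> serve for all
  \<open>t \<ge> s\<close>.\<close>

lemma ln_one_plus_scale:
  fixes w y :: real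
  assumes "0 \<le> w" "w \<le> 1" "0 \<le> y"
  shows "w * ln (1 + y) \<le> ln (1 + w * y)"
proof -
  define F where "F x = ln (1 + w * x) - w * ln (1 + x)" for x
  have "F 0 \<le> F y"
  proof (rule DERIV_nonneg_mono[OF assms(3), where f = F and f' = "\<lambda>x. w / (1 + w * x) - w / (1 + x)"])
    fix x :: real assume x: "0 \<le> x"
    have "w * x \<le> x" using x assms by (simp add: mult_left_le_one_le)
    moreover have "0 \<le> w * x" using x assms by simp
    ultimately show "0 \<le> w / (1 + w * x) - w / (1 + x)"
      using x assms by (simp add: divide_left_mono add_pos_nonneg)
    show "(F has_real_derivative w / (1 + w * x) - w / (1 + x)) (at x)"
      unfolding F_def using x \<open>0 \<le> w * x\<close> by (auto intro!: derivative_eq_intros)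
  qed
  then show ?thesis by (simp add: F_def)
qed

section \<open>Line crossings of the empirical process\<close>

text \<open>Turns a sum over the possible sets of surviving points into the binomial sum of the
  thinning inequality.\<close>

lemma sum_Pow_card:
  fixes f :: "nat \<Rightarrow> real"
  assumes "finite S"
  shows "(\<Sum>B\<in>Pow S. f (card B)) = (\<Sum>i\<le>card S. real (card S choose i) * f i)"
proof -
  have "(\<Sum>B\<in>Pow S. f (card B)) = (\<Sum>i\<in>{..card S}. \<Sum>B\<in>{B \<in> Pow S. card B = i}. f (card B))"
    using assms by (intro sum.group[symmetric]) (auto intro: card_mono)
  also have "\<dots> = (\<Sum>i\<le>card S. real (card {B \<in> Pow S. card B = i}) * f i)"
    by (intro sum.cong) auto
  also have "\<dots> = (\<Sum>i\<le>card S. real (card S choose i) * f i)"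
    using n_subsets[OF assms] by (simp add: Pow_def)
  finally show ?thesis .
qed

text \<open>Read backwards in time, the number of sample points below \<open>t\<close> is a pure death process. Up to the
  factor \<open>t ^ k\<close>, \<open>\<psi> k t\<close> is a supermartingale weight: the derivative condition is the generator inequality
  for \<open>\<psi> k t / t ^ k\<close>, and the binomial sum is the expectation after thinning \<open>s\<close> to \<open>r\<close>.\<close>

lemma binomial_thinning:
  fixes \<psi> :: "nat \<Rightarrow> real \<Rightarrow> real"
  assumes deriv: "\<And>k t. 0 < t \<Longrightarrow> t \<le> s \<Longrightarrow> (\<psi> k has_real_derivative \<psi>' k t) (at t)"
    and super: "\<And>k t. 0 < t \<Longrightarrow> t \<le> s \<Longrightarrow> real k * \<psi> (k - 1) t \<le> \<psi>' k t"
    and r: "0 < r" "r \<le> s"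
  shows "(\<Sum>i\<le>k. real (k choose i) * ((s - r) ^ (k - i) * \<psi> i r)) \<le> \<psi> k s"
proof -
  \<comment> \<open>\<open>V\<close> interpolates in the intermediate time \<open>x\<close>:
    \<open>V r\<close> is the left-hand side, and in \<open>V s\<close> only the term
    \<open>i = k\<close> survives because \<open>0 ^ 0 = 1\<close>. It remains to see that
    \<open>V\<close> is nondecreasing.\<close>
  define V where "V x = (\<Sum>i\<le>k. real (k choose i) * ((s - x) ^ (k - i) * \<psi> i x))" for x
  define V' where "V' x = (\<Sum>i\<le>k. real (k choose i) *
     ((s - x) ^ (k - i) * \<psi>' i x - real (k - i) * (s - x) ^ (k - i - 1) * \<psi> i x))" for x
  have V: "(V has_real_derivative V' x) (at x)" if "r \<le> x" "x \<le> s" for x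
  proof -
    have "((\<lambda>x. (s - x) ^ (k - i) * \<psi> i x) has_real_derivative
       (s - x) ^ (k - i) * \<psi>' i x - real (k - i) * (s - x) ^ (k - i - 1) * \<psi> i x) (at x)" for i
      using that r by (auto intro!: derivative_eq_intros deriv)
    then show ?thesis
      unfolding V_def V'_def by (intro DERIV_sum DERIV_cmult)
  qed
  have "0 \<le> V' x" if x: "r \<le> x" "x \<le> s" for x
  proof (cases k)
    case 0
    then show ?thesis using super[of x 0] x r by (simp add: V'_def)
  next
    case (Suc n)
    have "(\<Sum>i\<le>k. real (k choose i) * (real (k - i) * (s - x) ^ (k - i - 1) * \<psi> i x))
        = (\<Sum>i\<le>n. real (k choose i) * (real (k - i) * (s - x) ^ (k - i - 1) * \<psi> i x))"
      by (simp add: Suc)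
    \<comment> \<open>Shifting the index by the absorption identities gives these terms the same
      coefficients as the \<open>\<psi>'\<close> terms, so \<open>super\<close> compares them one by
      one. The unmatched term \<open>i = 0\<close> is nonnegative by \<open>super\<close> at
      \<open>k = 0\<close>.\<close>
    also have "\<dots> = (\<Sum>i\<le>n. real (k choose Suc i) * ((s - x) ^ (k - Suc i) * (real (Suc i) * \<psi> i x)))"
    proof (rule sum.cong)
      fix i
      have "(k - i) * (k choose i) = k * (n choose i)" using binomial_absorb_comp[of k i] by (simp add: Suc)
      also have "\<dots> = (k choose Suc i) * Suc i" using Suc_times_binomial[of i n] by (simp add: Suc mult.commute)
      finally have "real (k - i) * real (k choose i) = real (k choose Suc i) * real (Suc i)"
        by (metis of_nat_mult)
      then show "real (k choose i) * (real (k - i) * (s - x) ^ (k - i - 1) * \<psi> i x)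
          = real (k choose Suc i) * ((s - x) ^ (k - Suc i) * (real (Suc i) * \<psi> i x))"
        by (simp add: mult_ac)
    qed simp
    also have "\<dots> \<le> (\<Sum>i\<le>n. real (k choose Suc i) * ((s - x) ^ (k - Suc i) * \<psi>' (Suc i) x))"
      using super[of x "Suc _"] x r by (intro sum_mono mult_left_mono) auto
    also have "\<dots> \<le> (\<Sum>i\<le>k. real (k choose i) * ((s - x) ^ (k - i) * \<psi>' i x))"
      using super[of x 0] x r unfolding Suc sum.atMost_Suc_shift by simp
    finally show ?thesis
      by (simp add: V'_def right_diff_distrib sum_subtractf)
  qed
  then have "V r \<le> V s"
    using r V DERIV_nonneg_imp_nondecreasing[of r s V] by blast
  also have "V s = (\<Sum>i\<le>k. if i = k then \<psi> k s else 0)"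
    unfolding V_def by (intro sum.cong) auto
  finally show ?thesis by (simp add: V_def)
qed

section \<open>Measurability of counts\<close>

lemma measurable_card_le:
  fixes f :: "'i \<Rightarrow> 'a \<Rightarrow> real"
  assumes "finite S" "\<And>i. i \<in> S \<Longrightarrow> f i \<in> borel_measurable M" "g \<in> borel_measurable M"
  shows "(\<lambda>x. card {i \<in> S. f i x \<le> g x}) \<in> measurable M (count_space UNIV)"
proof -
  have "(\<lambda>x. \<Sum>i\<in>S. if f i x \<le> g x then 1 else 0 :: nat) \<in> measurable M (count_space UNIV)"
    using assms(2,3) by measurable
  moreover have "(\<Sum>i\<in>S. if f i x \<le> g x then 1 else 0 :: nat) = card {i \<in> S. f i x \<le> g x}" for x
    using assms(1) by (simp add: sum.If_cases Int_def conj_commute)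
  ultimately show ?thesis by simp
qed

lemma pred_card_le:
  fixes f :: "'i \<Rightarrow> 'a \<Rightarrow> real"
  assumes "finite S" "\<And>i. i \<in> S \<Longrightarrow> f i \<in> borel_measurable M" "g \<in> borel_measurable M"
  shows "Measurable.pred M (\<lambda>x. R (card {i \<in> S. f i x \<le> g x}))"
  using measurable_compose[OF measurable_card_le[OF assms], where g = R] by simp

section \<open>Maximal inequality for independent uniform variables\<close>

locale uniform_sample = prob_space M for M :: "'a measure" +
  fixes H :: "'i set" and p :: "'i \<Rightarrow> 'a \<Rightarrow> real"
  assumes finite_H: "finite H"
    and indep: "indep_vars (\<lambda>_. borel) p H"
    and uniform: "i \<in> H \<Longrightarrow> distr M borel (p i) = uniform_measure lborel {0..1}"
    and p_range: "i \<in> H \<Longrightarrow> \<omega> \<in> space M \<Longrightarrow> p i \<omega> \<in> {0..1}"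
begin

lemma p_measurable: "i \<in> H \<Longrightarrow> p i \<in> borel_measurable M"
  using indep unfolding indep_vars_def by auto

lemma prob_all_in:
  assumes "S \<subseteq> H" "B \<in> sets borel"
  shows "prob {\<omega> \<in> space M. \<forall>i\<in>S. p i \<omega> \<in> B} = measure lborel ({0..1} \<inter> B) ^ card S"
proof (cases "S = {}")
  case True
  then show ?thesis by (simp add: prob_space)
next
  case False
  have "{\<omega> \<in> space M. \<forall>i\<in>S. p i \<omega> \<in> B} = (\<Inter>i\<in>S. p i -` B \<inter> space M)"
    using False by auto
  then have "prob {\<omega> \<in> space M. \<forall>i\<in>S. p i \<omega> \<in> B} = (\<Prod>i\<in>S. prob (p i -` B \<inter> space M))"
    using indep_varsD_finite[OF indep_vars_subset[OF indep assms(1)] False] assms finite_H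
    by (simp add: finite_subset)
  also have "\<dots> = (\<Prod>i\<in>S. measure lborel ({0..1} \<inter> B))"
  proof (rule prod.cong)
    fix i assume "i \<in> S"
    then have i: "i \<in> H" using assms by auto
    have "prob (p i -` B \<inter> space M) = measure (distr M borel (p i)) B"
      using p_measurable[OF i] assms by (simp add: measure_distr)
    then show "prob (p i -` B \<inter> space M) = measure lborel ({0..1} \<inter> B)"
      using assms by (simp add: uniform[OF i])
  qed simp
  finally show ?thesis by simp
qed

lemma prob_all_le:
  assumes "S \<subseteq> H" "0 \<le> b" "b \<le> 1"
  shows "prob {\<omega> \<in> space M. \<forall>i\<in>S. p i \<omega> \<le> b} = b ^ card S"
proof -
  have "{0..1} \<inter> {..b} = {0..b}" using assms by auto
  then show ?thesis using prob_all_in[of S "{..b}"] assms by simp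
qed

lemma prob_all_between:
  assumes "S \<subseteq> H" "0 \<le> a" "a \<le> b" "b \<le> 1"
  shows "prob {\<omega> \<in> space M. \<forall>i\<in>S. a < p i \<omega> \<and> p i \<omega> \<le> b} = (b - a) ^ card S"
proof -
  have "{0..1} \<inter> {a<..b} = {a<..b}" using assms by auto
  then show ?thesis using prob_all_in[of S "{a<..b}"] assms by simp
qed

text \<open>Invariance under \<open>restrict\<close> says that \<open>P\<close> and \<open>Q\<close>
  read only the coordinates in \<open>A\<close> and in \<open>B\<close>, and disjoint blocks of an
  independent family are independent.\<close>

lemma prob_indep_blocks:
  assumes "A \<subseteq> H" "B \<subseteq> H" "A \<inter> B = {}"
    and P: "{x \<in> space (PiM A (\<lambda>_. borel)). P x} \<in> sets (PiM A (\<lambda>_. borel))"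
    and Q: "{x \<in> space (PiM B (\<lambda>_. borel)). Q x} \<in> sets (PiM B (\<lambda>_. borel))"
    and P_restrict: "\<And>x. P (restrict x A) = P x" and Q_restrict: "\<And>x. Q (restrict x B) = Q x"
  shows "prob {\<omega> \<in> space M. P (\<lambda>i. p i \<omega>) \<and> Q (\<lambda>i. p i \<omega>)}
    = prob {\<omega> \<in> space M. P (\<lambda>i. p i \<omega>)} * prob {\<omega> \<in> space M. Q (\<lambda>i. p i \<omega>)}"
  using indep_varD[OF indep_var_restrict[OF indep assms(3,1,2)] P Q]
  by (simp add: vimage_def Int_def space_PiM P_restrict Q_restrict conj_commute)

text \<open>A maximal inequality: \<open>t ^ k \<le> \<psi> k t\<close> says that the weight
  \<open>\<psi> k t / t ^ k\<close> has reached 1. Keeping the event that all of \<open>S\<close>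
  lies below \<open>s\<close> inside the probability avoids conditioning. The induction adds a new
  largest time \<open>b\<close> and splits by the set \<open>B\<close> of points at or below
  \<open>b\<close>: stop if the weight reaches 1 at \<open>b\<close>, otherwise continue from
  \<open>b\<close> with \<open>B\<close>. Thinning from \<open>s\<close> to \<open>b\<close> sums
  the cases.\<close>

lemma crossing_grid:
  fixes \<psi> :: "nat \<Rightarrow> real \<Rightarrow> real"
  assumes deriv: "\<And>k t. 0 < t \<Longrightarrow> t \<le> 1 \<Longrightarrow> (\<psi> k has_real_derivative \<psi>' k t) (at t)"
    and super: "\<And>k t. 0 < t \<Longrightarrow> t \<le> 1 \<Longrightarrow> real k * \<psi> (k - 1) t \<le> \<psi>' k t"
    and nonneg: "\<And>k t. 0 < t \<Longrightarrow> t \<le> 1 \<Longrightarrow> 0 \<le> \<psi> k t"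
    and "finite T" "T \<subseteq> {0<..s}" "s \<le> 1" "0 < s" "S \<subseteq> H"
  shows "prob {\<omega> \<in> space M. (\<forall>i\<in>S. p i \<omega> \<le> s) \<and>
      (\<exists>t\<in>T. t ^ card {i \<in> S. p i \<omega> \<le> t} \<le> \<psi> (card {i \<in> S. p i \<omega> \<le> t}) t)} \<le> \<psi> (card S) s"
  using assms(4-8)
proof (induction T arbitrary: s S rule: finite_linorder_max_induct)
  case empty
  then show ?case using nonneg by simp
next
  case (insert b T)
  note [measurable] = p_measurable
  \<comment> \<open>\<open>hit\<close> is a crossing at one of the earlier grid times.
    \<open>P B\<close> and \<open>Q B\<close> together say that exactly the points of
    \<open>B\<close> lie at or below \<open>b\<close>, the others in \<open>(b, s]\<close>, and that
    a crossing occurs at \<open>b\<close> or below.\<close>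
  define hit where "hit B x = (\<exists>t\<in>T. t ^ card {i \<in> B. x i \<le> t} \<le> \<psi> (card {i \<in> B. x i \<le> t}) t)"
    for B and x :: "'i \<Rightarrow> real"
  define Q where "Q B x = ((\<forall>i\<in>B. x i \<le> b) \<and> (b ^ card B \<le> \<psi> (card B) b \<or> hit B x))"
    for B and x :: "'i \<Rightarrow> real"
  define P where "P B x = (\<forall>i\<in>S - B. b < x i \<and> x i \<le> s)" for B and x :: "'i \<Rightarrow> real"
  have b: "0 < b" "b \<le> s" "b \<le> 1" using insert.prems by auto
  have finS: "finite S" using insert.prems finite_H finite_subset by blast
  have meas_P: "{x \<in> space N. P B (\<lambda>i. f i x)} \<in> sets N"
    if f: "\<And>i. i \<in> S - B \<Longrightarrow> f i \<in> borel_measurable N" for N B and f :: "'i \<Rightarrow> 'b \<Rightarrow> real"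
  proof -
    have "Measurable.pred N (\<lambda>x. b < f i x \<and> f i x \<le> s)" if "i \<in> S - B" for i
    proof -
      have [measurable]: "f i \<in> borel_measurable N" using f that .
      show ?thesis by measurable
    qed
    then show ?thesis using finS unfolding P_def by (intro sets.sets_Collect_finite_All) (auto simp: pred_def)
  qed
  have meas_Q: "{x \<in> space N. Q B (\<lambda>i. f i x)} \<in> sets N"
    if "\<And>i. i \<in> B \<Longrightarrow> f i \<in> borel_measurable N" "finite B" for N B and f :: "'i \<Rightarrow> 'b \<Rightarrow> real"
  proof -
    have [measurable]: "Measurable.pred N (\<lambda>x. t ^ card {i \<in> B. f i x \<le> t} \<le> \<psi> (card {i \<in> B. f i x \<le> t}) t)" for t
      using that by (intro pred_card_le[where R = "\<lambda>k. t ^ k \<le> \<psi> k t"]) auto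
    show ?thesis using that insert.hyps(1) unfolding Q_def hit_def by measurable
  qed
  have "{\<omega> \<in> space M. (\<forall>i\<in>S. p i \<omega> \<le> s) \<and>
      (\<exists>t\<in>insert b T. t ^ card {i \<in> S. p i \<omega> \<le> t} \<le> \<psi> (card {i \<in> S. p i \<omega> \<le> t}) t)}
    \<subseteq> (\<Union>B\<in>Pow S. {\<omega> \<in> space M. P B (\<lambda>i. p i \<omega>) \<and> Q B (\<lambda>i. p i \<omega>)})"
  proof clarify
    fix \<omega> t
    assume \<omega>: "\<omega> \<in> space M" "\<forall>i\<in>S. p i \<omega> \<le> s" and t: "t \<in> insert b T"
      "t ^ card {i \<in> S. p i \<omega> \<le> t} \<le> \<psi> (card {i \<in> S. p i \<omega> \<le> t}) t"
    define B where "B = {i \<in> S. p i \<omega> \<le> b}"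
    have "Q B (\<lambda>i. p i \<omega>)"
    proof (cases "t = b")
      case True
      then show ?thesis using t by (simp add: Q_def B_def)
    next
      case False
      then have "t \<in> T" "t < b" using t insert.hyps by auto
      then have "{i \<in> S. p i \<omega> \<le> t} = {i \<in> B. p i \<omega> \<le> t}" by (auto simp: B_def)
      then have "hit B (\<lambda>i. p i \<omega>)" using t(2) \<open>t \<in> T\<close> unfolding hit_def by metis
      then show ?thesis by (simp add: Q_def B_def)
    qed
    moreover have "P B (\<lambda>i. p i \<omega>)" using \<omega> by (auto simp: P_def B_def)
    ultimately show "\<omega> \<in> (\<Union>B\<in>Pow S. {\<omega> \<in> space M. P B (\<lambda>i. p i \<omega>) \<and> Q B (\<lambda>i. p i \<omega>)})"
      using \<omega> by (auto simp: B_def)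
  qed
  moreover have sets_PQ: "{\<omega> \<in> space M. P B (\<lambda>i. p i \<omega>) \<and> Q B (\<lambda>i. p i \<omega>)} \<in> events" if "B \<subseteq> S" for B
    using that insert.prems finS finite_subset[OF that finS]
    by (intro sets.sets_Collect_conj meas_P meas_Q p_measurable) auto
  ultimately have "prob {\<omega> \<in> space M. (\<forall>i\<in>S. p i \<omega> \<le> s) \<and>
      (\<exists>t\<in>insert b T. t ^ card {i \<in> S. p i \<omega> \<le> t} \<le> \<psi> (card {i \<in> S. p i \<omega> \<le> t}) t)}
    \<le> prob (\<Union>B\<in>Pow S. {\<omega> \<in> space M. P B (\<lambda>i. p i \<omega>) \<and> Q B (\<lambda>i. p i \<omega>)})"
    using finS by (intro finite_measure_mono sets.finite_UN) auto
  also have "\<dots> \<le> (\<Sum>B\<in>Pow S. prob {\<omega> \<in> space M. P B (\<lambda>i. p i \<omega>) \<and> Q B (\<lambda>i. p i \<omega>)})"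
    using finS sets_PQ by (intro finite_measure_subadditive_finite) auto
  also have "\<dots> \<le> (\<Sum>B\<in>Pow S. (s - b) ^ (card S - card B) * \<psi> (card B) b)"
  proof (rule sum_mono)
    fix B assume "B \<in> Pow S"
    then have B: "B \<subseteq> S" "finite B" "B \<subseteq> H" using finS insert.prems finite_subset by auto
    have "S - B \<subseteq> H" using insert.prems by auto
    have "prob {\<omega> \<in> space M. P B (\<lambda>i. p i \<omega>) \<and> Q B (\<lambda>i. p i \<omega>)}
      = prob {\<omega> \<in> space M. P B (\<lambda>i. p i \<omega>)} * prob {\<omega> \<in> space M. Q B (\<lambda>i. p i \<omega>)}"
    proof (rule prob_indep_blocks[where A = "S - B" and B = B])
      show "P B (restrict x (S - B)) = P B x" for x by (simp add: P_def)
      have "{i \<in> B. restrict x B i \<le> t} = {i \<in> B. x i \<le> t}" for x :: "'i \<Rightarrow> real" and t by auto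
      then show "Q B (restrict x B) = Q B x" for x by (simp add: Q_def hit_def)
      show "{x \<in> space (PiM (S - B) (\<lambda>_. borel)). P B x} \<in> sets (PiM (S - B) (\<lambda>_. borel))"
        using meas_P[of B "\<lambda>i x. x i" "PiM (S - B) (\<lambda>_. borel)"] by simp
      show "{x \<in> space (PiM B (\<lambda>_. borel)). Q B x} \<in> sets (PiM B (\<lambda>_. borel))"
        using meas_Q[of B "\<lambda>i x. x i" "PiM B (\<lambda>_. borel)"] B by simp
    qed (use B insert.prems in auto)
    also have "prob {\<omega> \<in> space M. P B (\<lambda>i. p i \<omega>)} = (s - b) ^ (card S - card B)"
      using prob_all_between[of "S - B" b s] \<open>S - B \<subseteq> H\<close> insert.prems B b finS by (simp add: P_def card_Diff_subset)
    \<comment> \<open>If the weight has reached 1 at \<open>b\<close>, the probability that all of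
      \<open>B\<close> lies below \<open>b\<close> is already small enough; otherwise
      \<open>Q B\<close> forces a crossing below \<open>b\<close> and the induction hypothesis
      applies.\<close>
    also have "prob {\<omega> \<in> space M. Q B (\<lambda>i. p i \<omega>)} \<le> \<psi> (card B) b"
    proof (cases "b ^ card B \<le> \<psi> (card B) b")
      case True
      then show ?thesis using prob_all_le[of B b] b B by (simp add: Q_def)
    next
      case False
      then show ?thesis using insert.IH[of b B] insert.hyps insert.prems b B by (force simp: Q_def hit_def)
    qed
    finally show "prob {\<omega> \<in> space M. P B (\<lambda>i. p i \<omega>) \<and> Q B (\<lambda>i. p i \<omega>)}
      \<le> (s - b) ^ (card S - card B) * \<psi> (card B) b"
      using b by (simp add: mult_left_mono)
  qed
  also have "\<dots> = (\<Sum>i\<le>card S. real (card S choose i) * ((s - b) ^ (card S - i) * \<psi> i b))"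
    using finS by (rule sum_Pow_card)
  also have "\<dots> \<le> \<psi> (card S) s"
    using b insert.prems by (intro binomial_thinning[where \<psi>' = \<psi>'] deriv super) auto
  finally show ?case .
qed

abbreviation N :: "real \<Rightarrow> 'a \<Rightarrow> real" where
  "N t \<omega> \<equiv> real (card {i \<in> H. p i \<omega> \<le> t})"

text \<open>The exceptional event is quantified, so measurability of a condition over uncountably
  many \<open>t\<close> does not arise. The cutoff \<open>\<tau>\<close> serves the dyadic blocks of
  the Well bound; \<open>\<tau> = 0\<close> gives all of \<open>(0, 1]\<close>.\<close>

definition envelope :: "real \<Rightarrow> (real \<Rightarrow> real) \<Rightarrow> real \<Rightarrow> bool" where
  "envelope \<tau> f q \<longleftrightarrow> (\<exists>E\<in>events. prob E \<le> q \<and>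
     (\<forall>\<omega>\<in>space M - E. \<forall>t. 0 < t \<longrightarrow> \<tau> \<le> t \<longrightarrow> t \<le> 1 \<longrightarrow> N t \<omega> \<le> f t))"

lemma envelope_mono: "envelope \<tau> f q \<Longrightarrow> q \<le> q' \<Longrightarrow> envelope \<tau> f q'"
  unfolding envelope_def by (meson order_trans)

text \<open>Since the count is an integer and nondecreasing in \<open>t\<close>, a violation
  anywhere yields a crossing at one of finitely many times, where \<open>crossing_grid\<close>
  started at \<open>s = 1\<close> applies.\<close>

lemma linear_crossing:
  fixes \<psi> :: "nat \<Rightarrow> real \<Rightarrow> real"
  assumes deriv: "\<And>k t. 0 < t \<Longrightarrow> t \<le> 1 \<Longrightarrow> (\<psi> k has_real_derivative \<psi>' k t) (at t)"
    and super: "\<And>k t. 0 < t \<Longrightarrow> t \<le> 1 \<Longrightarrow> real k * \<psi> (k - 1) t \<le> \<psi>' k t"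
    and nonneg: "\<And>k t. 0 < t \<Longrightarrow> t \<le> 1 \<Longrightarrow> 0 \<le> \<psi> k t"
    and "0 < b"
    and line: "\<And>k t. 0 < t \<Longrightarrow> \<tau> \<le> t \<Longrightarrow> t \<le> 1 \<Longrightarrow> a + b * t \<le> real k \<Longrightarrow> t ^ k \<le> \<psi> k t"
  shows "envelope \<tau> (\<lambda>t. a + b * t) (\<psi> (card H) 1)"
proof -
  \<comment> \<open>The times at which the line has integer height, capped at the starting time
    1.\<close>
  define T where "T = (\<lambda>k. min 1 ((real k - a) / b)) ` {..card H} \<inter> {t. 0 < t}"
  define E where "E = {\<omega> \<in> space M. (\<forall>i\<in>H. p i \<omega> \<le> 1) \<and>
      (\<exists>t\<in>T. t ^ card {i \<in> H. p i \<omega> \<le> t} \<le> \<psi> (card {i \<in> H. p i \<omega> \<le> t}) t)}"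
  have T: "finite T" "T \<subseteq> {0<..1}" by (auto simp: T_def)
  note [measurable] = p_measurable
  have "E \<in> events"
  proof -
    have [measurable]: "Measurable.pred M (\<lambda>\<omega>. t ^ card {i \<in> H. p i \<omega> \<le> t} \<le> \<psi> (card {i \<in> H. p i \<omega> \<le> t}) t)" for t
      using p_measurable finite_H by (intro pred_card_le[where R = "\<lambda>k. t ^ k \<le> \<psi> k t"]) auto
    show ?thesis using T(1) finite_H unfolding E_def by measurable
  qed
  moreover have "prob E \<le> \<psi> (card H) 1"
    unfolding E_def using T by (intro crossing_grid[where \<psi>' = \<psi>'] deriv super nonneg) auto
  moreover have "N t \<omega> \<le> a + b * t" if \<omega>: "\<omega> \<in> space M - E" and t: "0 < t" "\<tau> \<le> t" "t \<le> 1" for \<omega> t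
  proof (rule ccontr)
    assume "\<not> N t \<omega> \<le> a + b * t"
    then have k: "a + b * t < N t \<omega>" by simp
    \<comment> \<open>Moving \<open>t\<close> up to where the line reaches the current count, or to
      1, leaves the process on or above the line and lands in \<open>T\<close>.\<close>
    define t' where "t' = min 1 ((N t \<omega> - a) / b)"
    have "t < (N t \<omega> - a) / b" using k \<open>0 < b\<close> by (simp add: field_simps)
    then have t': "t \<le> t'" "t' \<le> 1" using t by (auto simp: t'_def)
    have "t' \<le> (N t \<omega> - a) / b" by (simp add: t'_def)
    then have "a + b * t' \<le> N t \<omega>" using \<open>0 < b\<close> by (simp add: field_simps)
    also have "N t \<omega> \<le> N t' \<omega>" using t' finite_H by (auto intro!: card_mono)
    finally have "t' ^ card {i \<in> H. p i \<omega> \<le> t'} \<le> \<psi> (card {i \<in> H. p i \<omega> \<le> t'}) t'"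
      using t t' by (intro line) auto
    moreover have "t' \<in> T"
      using t t' finite_H unfolding T_def t'_def by (auto intro!: imageI card_mono)
    moreover have "\<forall>i\<in>H. p i \<omega> \<le> 1" using p_range \<omega> by auto
    ultimately show False using \<omega> by (auto simp: E_def)
  qed
  ultimately show ?thesis unfolding envelope_def by blast
qed

section \<open>Envelopes for the four methods\<close>

lemma simes_event:
  fixes m \<delta> :: real
  assumes "real (card H) \<le> m" "0 < m" "0 < \<delta>"
  shows "envelope 0 (\<lambda>t. m / \<delta> * t) \<delta>"
proof -
  \<comment> \<open>The weight \<open>\<psi> k t / t ^ k\<close> is
    \<open>k * \<delta> / (m * t)\<close>: it equals 1 on the line, and its starting value is
    \<open>card H * \<delta> / m\<close>.\<close>
  define \<psi> where "\<psi> k t = real k * t ^ (k - 1) * (\<delta> / m)" for k and t :: real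
  define \<psi>' where "\<psi>' k t = real k * (real (k - 1) * t ^ (k - 1 - 1)) * (\<delta> / m)" for k and t :: real
  have "envelope 0 (\<lambda>t. 0 + m / \<delta> * t) (\<psi> (card H) 1)"
  proof (rule linear_crossing[where \<psi>' = \<psi>'])
    show "(\<psi> k has_real_derivative \<psi>' k t) (at t)" for k t
      unfolding \<psi>_def \<psi>'_def using assms by (auto intro!: derivative_eq_intros)
    show "real k * \<psi> (k - 1) t \<le> \<psi>' k t" for k t
      by (simp add: \<psi>_def \<psi>'_def)
    show "0 \<le> \<psi> k t" if "0 < t" for k t using that assms by (simp add: \<psi>_def)
    show "0 < m / \<delta>" using assms by simp
    show "t ^ k \<le> \<psi> k t" if "0 < t" "0 + m / \<delta> * t \<le> real k" for k t
    proof -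
      have "0 < m / \<delta> * t" using that assms by simp
      then have "0 < k" using that by (cases k) auto
      have "t \<le> real k * (\<delta> / m)" using that assms by (simp add: field_simps)
      then have "t ^ (k - 1) * t \<le> t ^ (k - 1) * (real k * (\<delta> / m))"
        using that by (intro mult_left_mono) auto
      then show ?thesis using \<open>0 < k\<close> by (simp add: \<psi>_def power_eq_if mult_ac)
    qed
  qed
  moreover have "\<psi> (card H) 1 \<le> \<delta>"
    using assms by (simp add: \<psi>_def field_simps)
  ultimately show ?thesis by (auto intro: envelope_mono)
qed

text \<open>On or above the line \<open>A + m * t \<le> k\<close>, so the fraction in
  \<open>\<phi>\<close> is at most 1 and the weight is at least 1. At \<open>t = 1\<close>, since
  \<open>card H \<le> m\<close>, the weight is at most \<open>exp (- 2 * A\<^sup>2 / m)\<close>,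
  which is \<open>\<delta>\<close> by the choice of \<open>A\<close>.\<close>

lemma dkw_event:
  fixes m \<delta> :: real
  assumes "real (card H) \<le> m" "0 < m" "0 < \<delta>" "\<delta> < 1"
  shows "envelope 0 (\<lambda>t. sqrt (m * (1 / 2 * ln (1 / \<delta>))) + m * t) \<delta>"
proof -
  define A where "A = sqrt (m * (1 / 2 * ln (1 / \<delta>)))"
  have A: "0 \<le> A" "2 * A\<^sup>2 / m = ln (1 / \<delta>)"
    using assms by (simp_all add: A_def)
  define \<phi> where "\<phi> y t = exp (- (6 * A * ((3 * (m * t) + A) / (y + 2 * (m * t)) - 1)))" for y t :: real
  define \<psi> where "\<psi> k t = t ^ k * \<phi> (real k) t" for k and t :: real
  define \<psi>' where "\<psi>' k t = real k * t ^ (k - 1) * \<phi> (real k) t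
     - t ^ k * (6 * A * m * (3 * real k - 2 * A) / (real k + 2 * (m * t))\<^sup>2) * \<phi> (real k) t" for k t
  have "envelope 0 (\<lambda>t. A + m * t) (\<psi> (card H) 1)"
  proof (rule linear_crossing[where \<psi>' = \<psi>'])
    show "(\<psi> k has_real_derivative \<psi>' k t) (at t)" if "0 < t" for k t
    proof -
      define e where "e = real k + 2 * (m * t)"
      have e: "0 < e" using that assms by (simp add: e_def add_nonneg_pos)
      have "((\<lambda>t. (3 * (m * t) + A) / (real k + 2 * (m * t))) has_real_derivative
          (3 * m * e - (3 * (m * t) + A) * (2 * m)) / (e * e)) (at t)"
        using e unfolding e_def by (auto intro!: derivative_eq_intros)
      also have "3 * m * e - (3 * (m * t) + A) * (2 * m) = m * (3 * real k - 2 * A)"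
        by (simp add: e_def algebra_simps)
      finally have [derivative_intros]: "((\<lambda>t. (3 * (m * t) + A) / (real k + 2 * (m * t))) has_real_derivative
          m * (3 * real k - 2 * A) / (e * e)) (at t)" .
      have "(\<phi> (real k) has_real_derivative
          \<phi> (real k) t * - (6 * A * (m * (3 * real k - 2 * A) / (e * e)))) (at t)"
        unfolding \<phi>_def by (auto intro!: derivative_eq_intros)
      then show ?thesis
        unfolding \<psi>_def \<psi>'_def e_def[symmetric]
        by (auto intro!: derivative_eq_intros simp: power2_eq_square algebra_simps)
    qed
    show "real k * \<psi> (k - 1) t \<le> \<psi>' k t" if t: "0 < t" for k t
    proof (cases k)
      case 0
      then show ?thesis using A assms by (simp add: \<psi>'_def \<phi>_def divide_nonpos_nonneg mult_nonneg_nonpos)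
    next
      case (Suc n)
      define e where "e = real k + 2 * (m * t)"
      define c where "c = 6 * A * m * (3 * real k - 2 * A) / e\<^sup>2"
      define q u where "q = A / e" and "u = 2 * (m * t) / e"
      have k: "0 < real k" using Suc by simp
      have S: "0 < m * t" using t assms by simp
      have e: "0 < e" "0 < e - 1" using S Suc by (auto simp: e_def)
      have u: "0 \<le> u" "u < 1" "1 - u = real k / e" using e S k by (auto simp: u_def e_def field_simps)
      \<comment> \<open>Losing one point replaces \<open>e\<close> by \<open>e - 1\<close>.
        Weakening \<open>1 / ((e - 1) * e)\<close> to \<open>1 / (e * e)\<close> leaves an exponent
        depending on \<open>q\<close> and \<open>u\<close> only, ready for
        \<open>dkw_exp_bound\<close>.\<close>
      have "(3 * (m * t) + A) / (real n + 2 * (m * t)) - (3 * (m * t) + A) / e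
          = (3 * (m * t) + A) / ((e - 1) * e)"
        using e by (simp add: Suc e_def divide_simps) (simp add: algebra_simps)
      also have "\<dots> \<ge> (3 * (m * t) + A) / (e * e)"
        using e S A by (intro divide_left_mono mult_right_mono mult_pos_pos) auto
      finally have "6 * A * ((3 * (m * t) + A) / (e * e)) \<le>
          6 * A * ((3 * (m * t) + A) / (real n + 2 * (m * t)) - (3 * (m * t) + A) / e)"
        using A by (intro mult_left_mono) auto
      moreover have "6 * A * ((3 * (m * t) + A) / (e * e)) = 9 * q * u + 6 * q\<^sup>2"
        using e by (simp add: q_def u_def field_simps power2_eq_square)
      ultimately have "- (6 * A * ((3 * (m * t) + A) / (real n + 2 * (m * t)) - 1))
          \<le> - (6 * A * ((3 * (m * t) + A) / e - 1)) + - (9 * q * u + 6 * q\<^sup>2)"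
        by (simp add: algebra_simps)
      then have "\<phi> (real n) t \<le> \<phi> (real k) t * exp (- (9 * q * u + 6 * q\<^sup>2))"
        unfolding \<phi>_def e_def[symmetric] mult_exp_exp by simp
      also have "\<dots> \<le> \<phi> (real k) t * (1 - 9 * q * u + 6 * q\<^sup>2 * u / (1 - u))"
        using u e A by (intro mult_left_mono dkw_exp_bound) (auto simp: \<phi>_def q_def)
      finally have "real k * t ^ n * \<phi> (real n) t
          \<le> real k * t ^ n * (\<phi> (real k) t * (1 - 9 * q * u + 6 * q\<^sup>2 * u / (1 - u)))"
        using t by (intro mult_left_mono) auto
      \<comment> \<open>Here \<open>1 - u = k / e\<close> enters; \<open>c\<close> is the
        coefficient produced by differentiating \<open>\<phi>\<close> in \<open>t\<close>, so the
        bound becomes \<open>\<psi>'\<close> itself.\<close>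
      also have "1 - 9 * q * u + 6 * q\<^sup>2 * u / (1 - u) = 1 - t * c / real k"
        unfolding u(3) using e k by (simp add: q_def u_def c_def field_simps power2_eq_square)
      also have "real k * t ^ n * (\<phi> (real k) t * (1 - t * c / real k))
          = real k * t ^ n * \<phi> (real k) t - t * t ^ n * c * \<phi> (real k) t"
        using k by (simp add: field_simps)
      finally show ?thesis
        unfolding \<psi>_def \<psi>'_def e_def[symmetric] c_def[symmetric] by (simp add: Suc)
    qed
    show "0 \<le> \<psi> k t" if "0 < t" for k t using that by (simp add: \<psi>_def \<phi>_def)
    show "0 < m" by fact
    show "t ^ k \<le> \<psi> k t" if "0 < t" "A + m * t \<le> real k" for k t
    proof -
      have "0 < m * t" using that assms by simp
      then have "(3 * (m * t) + A) / (real k + 2 * (m * t)) \<le> 1" using that A by (simp add: field_simps)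
      then have "1 \<le> \<phi> (real k) t" using A by (simp add: \<phi>_def mult_nonneg_nonpos)
      then show ?thesis using that mult_left_mono[of 1 "\<phi> (real k) t" "t ^ k"] by (simp add: \<psi>_def)
    qed
  qed
  moreover have "\<psi> (card H) 1 \<le> \<delta>"
  proof -
    have "(3 * m + A) / (m + 2 * m) \<le> (3 * m + A) / (real (card H) + 2 * m)"
      using assms A by (intro divide_left_mono mult_pos_pos add_nonneg_pos) auto
    then have "A / (3 * m) \<le> (3 * m + A) / (real (card H) + 2 * m) - 1"
      using assms by (simp add: field_simps)
    then have "6 * A * (A / (3 * m)) \<le> 6 * A * ((3 * m + A) / (real (card H) + 2 * m) - 1)"
      using A by (intro mult_left_mono) auto
    moreover have "6 * A * (A / (3 * m)) = ln (1 / \<delta>)"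
      using A(2) by (simp add: power2_eq_square)
    ultimately have "\<psi> (card H) 1 \<le> exp (- ln (1 / \<delta>))"
      by (simp add: \<psi>_def \<phi>_def)
    then show ?thesis using assms by (simp add: ln_div)
  qed
  ultimately show ?thesis unfolding A_def by (rule envelope_mono)
qed

text \<open>The weight is \<open>c * (1 + \<gamma> / t) ^ k\<close>, for which the generator
  inequality is an equality. Its base is at least 1, so being at least 1 on the line suffices for
  being so above it; the starting value is bounded through
  \<open>1 + \<gamma> \<le> exp \<gamma>\<close>.\<close>

lemma exponential_crossing:
  fixes m \<gamma> c a b \<tau> :: real
  assumes "real (card H) \<le> m" "0 \<le> \<gamma>" "0 < c" "0 < b"
    and line: "\<And>t. 0 < t \<Longrightarrow> \<tau> \<le> t \<Longrightarrow> t \<le> 1 \<Longrightarrow> 1 \<le> c * exp ((a + b * t) * ln (1 + \<gamma> / t))"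
  shows "envelope \<tau> (\<lambda>t. a + b * t) (c * exp (m * \<gamma>))"
proof -
  define \<psi> where "\<psi> k t = c * (t + \<gamma>) ^ k" for k and t :: real
  define \<psi>' where "\<psi>' k t = c * (real k * (t + \<gamma>) ^ (k - 1))" for k and t :: real
  have "envelope \<tau> (\<lambda>t. a + b * t) (\<psi> (card H) 1)"
  proof (rule linear_crossing[where \<psi>' = \<psi>'])
    show "(\<psi> k has_real_derivative \<psi>' k t) (at t)" for k t
      unfolding \<psi>_def \<psi>'_def by (auto intro!: derivative_eq_intros)
    show "real k * \<psi> (k - 1) t \<le> \<psi>' k t" for k t by (simp add: \<psi>_def \<psi>'_def)
    show "0 \<le> \<psi> k t" if "0 < t" for k t using that assms by (simp add: \<psi>_def)
    show "0 < b" by fact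
    show "t ^ k \<le> \<psi> k t" if t: "0 < t" "\<tau> \<le> t" "t \<le> 1" and k: "a + b * t \<le> real k" for k t
    proof -
      have "0 \<le> \<gamma> / t" using t assms by simp
      have "(a + b * t) * ln (1 + \<gamma> / t) \<le> real k * ln (1 + \<gamma> / t)"
        using k \<open>0 \<le> \<gamma> / t\<close> by (intro mult_right_mono) auto
      then have "c * exp ((a + b * t) * ln (1 + \<gamma> / t)) \<le> c * exp (real k * ln (1 + \<gamma> / t))"
        using assms by simp
      with line[OF t] have "1 \<le> c * exp (real k * ln (1 + \<gamma> / t))" by linarith
      also have "exp (real k * ln (1 + \<gamma> / t)) = (1 + \<gamma> / t) ^ k"
        using \<open>0 \<le> \<gamma> / t\<close> by (subst exp_of_nat_mult) simp
      finally have "t ^ k * 1 \<le> t ^ k * (c * (1 + \<gamma> / t) ^ k)"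
        using t by (intro mult_left_mono) auto
      also have "\<dots> = c * (t * (1 + \<gamma> / t)) ^ k" by (simp add: power_mult_distrib)
      also have "t * (1 + \<gamma> / t) = t + \<gamma>" using t by (simp add: field_simps)
      finally show ?thesis by (simp add: \<psi>_def)
    qed
  qed
  moreover have "\<psi> (card H) 1 \<le> c * exp (m * \<gamma>)"
  proof -
    have "(1 + \<gamma>) ^ card H \<le> exp \<gamma> ^ card H"
      using assms by (intro power_mono exp_ge_add_one_self) auto
    also have "\<dots> = exp (real (card H) * \<gamma>)" by (simp add: exp_of_nat_mult)
    also have "\<dots> \<le> exp (m * \<gamma>)" using assms by (simp add: mult_right_mono)
    finally show ?thesis using assms by (simp add: \<psi>_def)
  qed
  ultimately show ?thesis by (auto intro: envelope_mono)
qed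

text \<open>With \<open>u = m * t\<close> and \<open>\<gamma> = g / m\<close>, the exponent along
  the line is \<open>C * (1 + u) * ln (1 + g / u)\<close>. By \<open>kr_rate_min\<close> at
  \<open>v = L\<close> it is at least \<open>C * (1 + g / L) * \<theta>\<close>, which equals
  \<open>L + g\<close> because \<open>C * \<theta> = L\<close>. Normalising by
  \<open>c = exp (- (L + g))\<close> leaves the starting value
  \<open>exp (- L) = \<delta>\<close>.\<close>

lemma kr_event:
  fixes m \<delta> :: real
  assumes "real (card H) \<le> m" "0 < m" "0 < \<delta>" "\<delta> < 1"
  defines "C \<equiv> ln (1 / \<delta>) / ln (1 + ln (1 / \<delta>))"
  shows "envelope 0 (\<lambda>t. C + C * m * t) \<delta>"
proof -
  define L \<theta> where "L = ln (1 / \<delta>)" and "\<theta> = ln (1 + L)"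
  define g where "g = L\<^sup>2 / ((1 + L) * \<theta> - L)"
  have L: "0 < L" "exp (- L) = \<delta>" using assms by (simp_all add: L_def ln_div)
  have \<theta>: "0 < \<theta>" using L by (simp add: \<theta>_def)
  have C: "C * \<theta> = L" "0 < C" using \<theta> L by (simp_all add: C_def L_def[symmetric] \<theta>_def[symmetric])
  have "L * \<theta> \<le> 2 * ((1 + L) * \<theta> - L)"
    using ln_one_plus_lower[of L] L by (simp add: \<theta>_def algebra_simps)
  moreover have "0 < L * \<theta>" using L \<theta> by simp
  ultimately have g: "0 < g" using L by (simp add: g_def)
  define c where "c = exp (- (C * ((1 + g / L) * \<theta>)))"
  have "envelope 0 (\<lambda>t. C + C * m * t) (c * exp (m * (g / m)))"
  proof (rule exponential_crossing)
    show "1 \<le> c * exp ((C + C * m * t) * ln (1 + g / m / t))" if "0 < t" for t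
    proof -
      have "(1 + g / L) * \<theta> \<le> (1 + m * t) * ln (1 + g / (m * t))"
        unfolding \<theta>_def using that L assms by (intro kr_rate_min) (auto simp: g_def \<theta>_def)
      then have "C * ((1 + g / L) * \<theta>) \<le> C * ((1 + m * t) * ln (1 + g / (m * t)))"
        using C by (intro mult_left_mono) auto
      also have "\<dots> = (C + C * m * t) * ln (1 + g / m / t)" by (simp add: algebra_simps)
      finally show ?thesis by (simp add: c_def mult_exp_exp)
    qed
  qed (use assms(1,2) g C(2) in \<open>simp_all add: c_def\<close>)
  moreover have "c * exp (m * (g / m)) = \<delta>"
  proof -
    have "C * ((1 + g / L) * \<theta>) = L * (1 + g / L)" using C(1) by (simp add: mult_ac)
    also have "\<dots> = L + g" using L by (simp add: field_simps)
    finally show ?thesis using assms L by (simp add: c_def mult_exp_exp)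
  qed
  ultimately show ?thesis by (auto intro: envelope_mono)
qed

text \<open>The choice \<open>\<gamma> = s * (\<mu> - 1)\<close> makes the base equal to
  \<open>\<mu>\<close> at \<open>t = s\<close>, and \<open>ln_one_plus_scale\<close> shows that on
  \<open>t \<ge> s\<close> the exponent along the line is smallest at \<open>t = s\<close>.
  Normalising there gives the exponent \<open>m * s * h \<mu>\<close>.\<close>

lemma wellner_block:
  fixes m s \<mu> :: real
  assumes "real (card H) \<le> m" "0 < m" "0 < s" "1 < \<mu>"
  shows "envelope s (\<lambda>t. \<mu> * m * t) (exp (- (m * s * h \<mu>)))"
proof -
  define c where "c = exp (- (\<mu> * m * s * ln \<mu>))"
  have "envelope s (\<lambda>t. 0 + \<mu> * m * t) (c * exp (m * (s * (\<mu> - 1))))"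
  proof (rule exponential_crossing)
    show "1 \<le> c * exp ((0 + \<mu> * m * t) * ln (1 + s * (\<mu> - 1) / t))" if "0 < t" "s \<le> t" for t
    proof -
      have "s / t * ln (1 + (\<mu> - 1)) \<le> ln (1 + s / t * (\<mu> - 1))"
        using that assms by (intro ln_one_plus_scale) auto
      then have "\<mu> * m * t * (s / t * ln \<mu>) \<le> \<mu> * m * t * ln (1 + s * (\<mu> - 1) / t)"
        using that assms by (intro mult_left_mono) auto
      then show ?thesis using that by (simp add: c_def mult_exp_exp)
    qed
  qed (use assms in \<open>auto simp: c_def\<close>)
  moreover have "c * exp (m * (s * (\<mu> - 1))) = exp (- (m * s * h \<mu>))"
    by (simp add: c_def mult_exp_exp h_def algebra_simps)
  ultimately show ?thesis by simp
qed

text \<open>A union bound over dyadic blocks: block \<open>n\<close> gets the slope whose failure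
  probability is at most \<open>\<delta> / (pi\<^sup>2 / 6) / (n + 1)\<^sup>2\<close>, and these sum
  to \<open>\<delta>\<close> by the Basel series.\<close>

lemma wellner_event:
  fixes m \<delta> :: real
  assumes "real (card H) \<le> m" "0 < m" "0 < \<delta>" "\<delta> < 1"
  shows "envelope 0 (\<lambda>t. h_inv ((2 * ln (pi\<^sup>2 / 6 / \<delta>) + 4 * ln (1 + log 2 (1 / t))) / (m * t)) * m * t) \<delta>"
proof -
  define L where "L = ln (pi\<^sup>2 / 6 / \<delta>)"
  have pi: "1 < pi\<^sup>2 / 6"
    using mult_strict_mono[OF pi_gt3 pi_gt3] by (simp add: power2_eq_square)
  have L: "0 < L" "exp (- L) = \<delta> / (pi\<^sup>2 / 6)"
    using pi assms by (simp_all add: L_def ln_div exp_diff)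
  \<comment> \<open>\<open>s n\<close> is the left end of the block
    \<open>[2 ^ -(n + 1), 2 ^ -n]\<close>, and \<open>x n\<close> is chosen so that
    \<open>m * s n * h (h_inv (x n))\<close> equals \<open>L + 2 * ln (n + 1)\<close>.\<close>
  define s where "s n = (1 / 2 ^ Suc n :: real)" for n
  define x where "x n = (L + 2 * ln (real n + 1)) / (m * s n)" for n
  have s: "0 < s n" for n by (simp add: s_def)
  have x: "0 < x n" for n using L s assms by (simp add: x_def add_pos_nonneg)
  define good where "good n E \<longleftrightarrow> E \<in> events \<and> prob E \<le> exp (- (m * s n * h (h_inv (x n)))) \<and>
     (\<forall>\<omega>\<in>space M - E. \<forall>t. 0 < t \<longrightarrow> s n \<le> t \<longrightarrow> t \<le> 1 \<longrightarrow> N t \<omega> \<le> h_inv (x n) * m * t)" for n E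
  have "\<exists>E. good n E" for n
    using wellner_block[OF assms(1,2) s[of n] h_inv_gt_1[OF x[of n]]] unfolding envelope_def good_def by blast
  then obtain E where "\<And>n. good n (E n)" by metis
  then have E: "\<And>n. E n \<in> events" "\<And>n. prob (E n) \<le> exp (- (m * s n * h (h_inv (x n))))"
    and N_le: "\<And>n. \<forall>\<omega>\<in>space M - E n. \<forall>t. 0 < t \<longrightarrow> s n \<le> t \<longrightarrow> t \<le> 1 \<longrightarrow> N t \<omega> \<le> h_inv (x n) * m * t"
    unfolding good_def by blast+
  have sums: "(\<lambda>n. \<delta> / (pi\<^sup>2 / 6) * (1 / (real n + 1)\<^sup>2)) sums (\<delta> / (pi\<^sup>2 / 6) * (pi\<^sup>2 / 6))"
    using inverse_squares_sums by (intro sums_mult) (simp add: add.commute)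
  have prob_E: "prob (E n) \<le> \<delta> / (pi\<^sup>2 / 6) * (1 / (real n + 1)\<^sup>2)" for n
  proof -
    have "m * s n * h (h_inv (x n)) = L + 2 * ln (real n + 1)"
      using s[of n] assms h_h_inv[OF x[of n]] by (simp add: x_def)
    then have "exp (- (m * s n * h (h_inv (x n)))) = exp (- L) * exp (- (2 * ln (real n + 1)))"
      by (simp add: mult_exp_exp)
    also have "exp (- (2 * ln (real n + 1))) = 1 / (real n + 1)\<^sup>2"
      by (simp add: exp_minus exp_double inverse_eq_divide)
    finally show ?thesis using E(2)[of n] L(2) by simp
  qed
  have summable: "summable (\<lambda>n. prob (E n))"
    using sums prob_E by (intro summable_comparison_test'[OF sums_summable[OF sums], of 0]) simp
  have "prob (\<Union>n. E n) \<le> (\<Sum>n. prob (E n))"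
    using E(1) summable by (intro finite_measure_subadditive_countably) auto
  also have "\<dots> \<le> (\<Sum>n. \<delta> / (pi\<^sup>2 / 6) * (1 / (real n + 1)\<^sup>2))"
    using prob_E summable sums_summable[OF sums] by (intro suminf_le) auto
  also have "\<dots> = \<delta>" using sums_unique[OF sums] by simp
  finally have "prob (\<Union>n. E n) \<le> \<delta>" .
  moreover have "N t \<omega> \<le> h_inv ((2 * L + 4 * ln (1 + log 2 (1 / t))) / (m * t)) * m * t"
    if \<omega>: "\<omega> \<in> space M - (\<Union>n. E n)" and t: "0 < t" "t \<le> 1" for \<omega> t
  proof -
    define l where "l = log 2 (1 / t)"
    have l: "0 \<le> l" "t = 2 powr (- l)" using t by (simp_all add: l_def powr_minus)
    define n where "n = nat \<lfloor>l\<rfloor>"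
    have n: "real n \<le> l" "l \<le> real n + 1" using l(1) by (simp_all add: n_def)
    have pow: "2 powr (- (real k)) = 1 / 2 ^ k" for k :: nat
      by (simp add: powr_minus powr_realpow divide_inverse)
    have "2 powr (- real (Suc n)) \<le> t" unfolding l(2) using n by (intro powr_mono) auto
    then have st: "s n \<le> t" unfolding pow s_def .
    have "t \<le> 2 powr (- real n)" unfolding l(2) using n by (intro powr_mono) auto
    then have ts: "t \<le> 2 * s n" unfolding pow s_def by simp
    have "N t \<omega> \<le> h_inv (x n) * m * t" using N_le[of n] \<omega> t st by auto
    also have "\<dots> \<le> h_inv ((2 * L + 4 * ln (1 + l)) / (m * t)) * m * t"
    proof -
      \<comment> \<open>Doubling numerator and denominator is the source of the factors 2 and 4:
        inside the block \<open>t \<le> 2 * s n\<close> and \<open>n \<le> l\<close>, so the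
        explicit expression in \<open>t\<close> dominates \<open>x n\<close>.\<close>
      have "x n = (2 * L + 4 * ln (real n + 1)) / (m * (2 * s n))"
        using s[of n] assms by (simp add: x_def field_simps)
      also have "\<dots> \<le> (2 * L + 4 * ln (1 + l)) / (m * t)"
        using ts t n L assms s[of n] by (intro frac_le add_mono mult_left_mono mult_pos_pos) auto
      finally show ?thesis
        using t assms by (intro mult_right_mono h_inv_mono x) auto
    qed
    finally show ?thesis by (simp add: l_def)
  qed
  ultimately show ?thesis
    using E(1) unfolding envelope_def L_def by (intro bexI[of _ "\<Union>n. E n"]) auto
qed

end

section \<open>The Benjamini--Hochberg procedure\<close>

text \<open>Sorting preserves the number of entries at most \<open>c\<close> and makes their
  positions an initial segment. This yields measurability of order statistics and, ties included,
  the lower bound \<open>k\<close> on the size of the rejection set.\<close>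

lemma ordered_pvalue_le_iff:
  assumes "k \<in> {1..m}"
  shows "ordered_pvalue m p k \<le> c \<longleftrightarrow> k \<le> card {i \<in> {1..m}. p i \<le> c}"
proof -
  define xs where "xs = sort (map p [1..<Suc m])"
  have xs: "sorted xs" "length xs = m" by (simp_all add: xs_def)
  have "length (filter (\<lambda>x. x \<le> c) xs) = length (filter (\<lambda>x. x \<le> c) (map p [1..<Suc m]))"
    unfolding xs_def by (metis mset_filter mset_sort size_mset)
  also have "\<dots> = card {i \<in> {1..m}. p i \<le> c}"
  proof -
    have "distinct (filter (\<lambda>i. p i \<le> c) [1..<Suc m])" by simp
    then show ?thesis
      by (subst filter_map, simp only: length_map o_def flip: distinct_card)
        (rule arg_cong[where f = card], auto)
  qed
  finally have len: "length (filter (\<lambda>x. x \<le> c) xs) = card {i \<in> {1..m}. p i \<le> c}" .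
  have len': "length (filter (\<lambda>x. x \<le> c) xs) = card {j. j < m \<and> xs ! j \<le> c}"
    by (simp add: length_filter_conv_card xs)
  have "xs ! (k - 1) \<le> c \<longleftrightarrow> k \<le> card {j. j < m \<and> xs ! j \<le> c}"
  proof
    assume *: "xs ! (k - 1) \<le> c"
    have "{..<k} \<subseteq> {j. j < m \<and> xs ! j \<le> c}"
    proof
      fix j assume "j \<in> {..<k}"
      then have "xs ! j \<le> xs ! (k - 1)" using assms xs by (intro sorted_nth_mono) auto
      then show "j \<in> {j. j < m \<and> xs ! j \<le> c}" using * \<open>j \<in> {..<k}\<close> assms by auto
    qed
    then have "card {..<k} \<le> card {j. j < m \<and> xs ! j \<le> c}" by (intro card_mono) auto
    then show "k \<le> card {j. j < m \<and> xs ! j \<le> c}" by simp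
  next
    assume *: "k \<le> card {j. j < m \<and> xs ! j \<le> c}"
    show "xs ! (k - 1) \<le> c"
    proof (rule ccontr)
      assume gt: "\<not> xs ! (k - 1) \<le> c"
      have "{j. j < m \<and> xs ! j \<le> c} \<subseteq> {..<k - 1}"
      proof
        fix j assume j: "j \<in> {j. j < m \<and> xs ! j \<le> c}"
        show "j \<in> {..<k - 1}"
        proof (rule ccontr)
          assume "j \<notin> {..<k - 1}"
          then have "xs ! (k - 1) \<le> xs ! j" using j xs by (intro sorted_nth_mono) auto
          then show False using gt j by auto
        qed
      qed
      then have "card {j. j < m \<and> xs ! j \<le> c} \<le> k - 1"
        using card_mono[of "{..<k - 1}"] by force
      then show False using * assms by auto
    qed
  qed
  then show ?thesis unfolding ordered_pvalue_def xs_def[symmetric] len'[symmetric] len .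
qed

text \<open>Replaces the maximum by finitely many comparisons with \<open>\<alpha>\<close>, as
  needed for measurability and right-constancy. The guard \<open>0 < k\<close> lets
  \<open>k = 0\<close> stand for the empty set of candidates.\<close>

lemma BH_count_eq_iff:
  "BH_count m \<alpha> p = k \<longleftrightarrow> k \<le> m \<and>
    (0 < k \<longrightarrow> real m * ordered_pvalue m p k / real k \<le> \<alpha>) \<and>
    (\<forall>l\<in>{Suc k..m}. \<alpha> < real m * ordered_pvalue m p l / real l)"
proof -
  define K where "K = {k \<in> {1..m}. real m * ordered_pvalue m p k / real k \<le> \<alpha>}"
  have K: "finite K" by (simp add: K_def)
  have eq: "BH_count m \<alpha> p = (if K = {} then 0 else Max K)"
    unfolding BH_count_def K_def Let_def by (rule refl)
  show ?thesis
  proof (cases "K = {}")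
    case True
    then have "BH_count m \<alpha> p = 0" by (simp add: eq)
    moreover have "\<alpha> < real m * ordered_pvalue m p l / real l" if "l \<in> {1..m}" for l
      using True that by (force simp: K_def)
    ultimately show ?thesis by (cases k) (force simp: not_less)+
  next
    case False
    define C where "C l \<longleftrightarrow> real m * ordered_pvalue m p l / real l \<le> \<alpha>" for l
    have K_eq: "K = {k \<in> {1..m}. C k}" by (simp add: K_def C_def)
    have "Max K = k \<longleftrightarrow> k \<in> K \<and> (\<forall>l\<in>K. l \<le> k)"
      using K False by (metis Max_in Max_ge Max_eqI)
    also have "\<dots> \<longleftrightarrow> k \<le> m \<and> (0 < k \<longrightarrow> C k) \<and> (\<forall>l\<in>{Suc k..m}. \<not> C l)"
    proof -
      have "(\<forall>l\<in>K. l \<le> k) \<longleftrightarrow> (\<forall>l\<in>{Suc k..m}. \<not> C l)"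
      proof
        show "\<forall>l\<in>{Suc k..m}. \<not> C l" if "\<forall>l\<in>K. l \<le> k"
        proof (intro ballI notI)
          fix l assume l: "l \<in> {Suc k..m}" "C l"
          then have "l \<in> K" unfolding K_eq by simp
          then show False using that l by fastforce
        qed
        show "\<forall>l\<in>K. l \<le> k" if "\<forall>l\<in>{Suc k..m}. \<not> C l"
        proof
          fix l assume "l \<in> K"
          then show "l \<le> k" using that unfolding K_eq by (cases "Suc k \<le> l") auto
        qed
      qed
      moreover have "\<not> (\<forall>l\<in>K. l \<le> 0)" using False unfolding K_eq by force
      ultimately show ?thesis unfolding K_eq by (cases "k = 0") auto
    qed
    finally show ?thesis using False by (simp add: eq C_def not_le)
  qed
qed

lemma BH_count_le: "BH_count m \<alpha> p \<le> m"
  using BH_count_eq_iff[of m \<alpha> p "BH_count m \<alpha> p"] by simp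

text \<open>Ties can only enlarge the rejection set, so the denominator is at least
  \<open>k\<close>; the BH criterion puts the \<open>k\<close>-th ordered p-value at or below
  \<open>\<alpha> * k / m\<close>.\<close>

lemma FDP_BH_le:
  assumes "H0 \<subseteq> {1..m}" and k: "k = BH_count m \<alpha> p" "0 < k"
  shows "FDP H0 (rejection_set m p k) \<le> real (card {i \<in> H0. p i \<le> \<alpha> * real k / real m}) / real k"
proof -
  have k_le: "k \<le> m" and crit: "real m * ordered_pvalue m p k / real k \<le> \<alpha>"
    using BH_count_eq_iff[of m \<alpha> p k] k by auto
  have m: "0 < m" using k k_le by simp
  have R: "rejection_set m p k = {i \<in> {1..m}. p i \<le> ordered_pvalue m p k}"
    using k by (simp add: rejection_set_def)
  have "k \<le> card (rejection_set m p k)"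
    unfolding R using ordered_pvalue_le_iff[of k m p "ordered_pvalue m p k"] k k_le by simp
  moreover have "card (rejection_set m p k \<inter> H0) \<le> card {i \<in> H0. p i \<le> \<alpha> * real k / real m}"
  proof (rule card_mono)
    show "finite {i \<in> H0. p i \<le> \<alpha> * real k / real m}"
      using assms(1) finite_subset by fastforce
    have "ordered_pvalue m p k \<le> \<alpha> * real k / real m"
      using crit m k by (simp add: field_simps)
    then show "rejection_set m p k \<inter> H0 \<subseteq> {i \<in> H0. p i \<le> \<alpha> * real k / real m}"
      unfolding R by auto
  qed
  ultimately show ?thesis
    unfolding FDP_def using k by (intro frac_le) auto
qed

lemma FDP_le_1: "FDP H0 (rejection_set m p k) \<le> 1"
proof -
  have "finite (rejection_set m p k)" by (simp add: rejection_set_def)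
  then have "card (rejection_set m p k \<inter> H0) \<le> card (rejection_set m p k)"
    by (intro card_mono) auto
  then show ?thesis unfolding FDP_def by simp
qed

text \<open>This reduces coverage at all levels to coverage at rational levels, hence to a measurable event.\<close>

lemma BH_count_right_constant:
  "\<exists>\<beta>>\<alpha>. \<forall>\<alpha>'\<in>{\<alpha>..<\<beta>}. BH_count m \<alpha>' p = BH_count m \<alpha> p"
proof -
  define r where "r l = real m * ordered_pvalue m p l / real l" for l
  define k where "k = BH_count m \<alpha> p"
  \<comment> \<open>The smallest threshold of an index beyond \<open>k\<close>, capped by
    \<open>\<alpha> + 1\<close> so that the minimum exists when there is none. Below it no larger
    index becomes admissible, and \<open>k\<close> stays admissible.\<close>
  define \<beta> where "\<beta> = Min (insert (\<alpha> + 1) (r ` {Suc k..m}))"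
  have k: "k \<le> m" "0 < k \<Longrightarrow> r k \<le> \<alpha>" "\<And>l. l \<in> {Suc k..m} \<Longrightarrow> \<alpha> < r l"
    using BH_count_eq_iff[of m \<alpha> p k] by (auto simp: r_def k_def)
  have "\<alpha> < \<beta>" unfolding \<beta>_def using k by (subst Min_gr_iff) auto
  moreover have "BH_count m \<alpha>' p = k" if "\<alpha>' \<in> {\<alpha>..<\<beta>}" for \<alpha>'
  proof -
    have "\<alpha>' < r l" if "l \<in> {Suc k..m}" for l
    proof -
      have "\<beta> \<le> r l" unfolding \<beta>_def using that by (intro Min_le) auto
      then show ?thesis using \<open>\<alpha>' \<in> {\<alpha>..<\<beta>}\<close> by auto
    qed
    then show ?thesis
      using BH_count_eq_iff[of m \<alpha>' p k] k that by (force simp: r_def)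
  qed
  ultimately show ?thesis unfolding k_def by blast
qed

section \<open>Regularity of the bounds in the level, and measurability\<close>

lemma well_argument_pos:
  fixes m k :: nat and \<alpha> \<delta> :: real
  assumes "0 < m" "k \<le> m" "0 < \<alpha>" "\<alpha> < 1" "0 < \<delta>" "\<delta> < 1"
  shows "0 < 1 + log 2 (real m / (\<alpha> * real (max 1 k)))"
    and "0 < (2 * ln (pi\<^sup>2 / 6 / \<delta>) + 4 * ln (1 + log 2 (real m / (\<alpha> * real (max 1 k))))) / (\<alpha> * real (max 1 k))"
proof -
  have "\<alpha> * real (max 1 k) \<le> 1 * real m"
    using assms by (intro mult_mono) auto
  then have log: "0 \<le> log 2 (real m / (\<alpha> * real (max 1 k)))"
    using assms by simp
  have "1 < pi\<^sup>2 / 6"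
    using mult_strict_mono[OF pi_gt3 pi_gt3] by (simp add: power2_eq_square)
  then have "0 < ln (pi\<^sup>2 / 6 / \<delta>)"
    using assms by (simp add: ln_gt_zero)
  then show "0 < (2 * ln (pi\<^sup>2 / 6 / \<delta>) + 4 * ln (1 + log 2 (real m / (\<alpha> * real (max 1 k))))) / (\<alpha> * real (max 1 k))"
    using log assms by (intro divide_pos_pos add_pos_nonneg) auto
  show "0 < 1 + log 2 (real m / (\<alpha> * real (max 1 k)))" using log by simp
qed

text \<open>Needed when nothing is rejected: the indicator is then 0, and the minimum must not drop
  below the false discovery proportion 0.\<close>

lemma raw_bound_nonneg:
  assumes "0 < m" "k \<le> m" "0 < \<alpha>" "\<alpha> < 1" "0 < \<delta>" "\<delta> < 1"
  shows "0 \<le> raw_bound meth m \<delta> \<alpha> k"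
proof (cases meth)
  case Well
  have "0 \<le> \<alpha> * h_inv ((2 * ln (pi\<^sup>2 / 6 / \<delta>) + 4 * ln (1 + log 2 (real m / (\<alpha> * real (max 1 k))))) / (\<alpha> * real (max 1 k)))"
    using h_inv_gt_1[OF well_argument_pos(2)[OF assms]] assms(3) by (intro mult_nonneg_nonneg) auto
  then show ?thesis unfolding Well raw_bound.simps .
next
  case KR
  have "0 \<le> ln (1 / \<delta>)" using assms(5,6) by simp
  moreover have "0 \<le> ln (1 + ln (1 / \<delta>))" using \<open>0 \<le> ln (1 / \<delta>)\<close> by (intro ln_ge_zero) simp
  ultimately show ?thesis using assms(3) unfolding KR raw_bound.simps
    by (intro mult_nonneg_nonneg divide_nonneg_nonneg add_nonneg_nonneg) auto
next
  case DKW
  have "0 \<le> ln (1 / \<delta>)" using assms(5,6) by simp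
  then show ?thesis using assms(3) unfolding DKW raw_bound.simps
    by (intro mult_nonneg_nonneg divide_nonneg_nonneg add_nonneg_nonneg real_sqrt_ge_zero) auto
qed (use assms in auto)

lemma isCont_raw_bound:
  assumes "0 < m" "k \<le> m" "0 < \<alpha>" "\<alpha> < 1" "0 < \<delta>" "\<delta> < 1"
  shows "isCont (\<lambda>\<alpha>. raw_bound meth m \<delta> \<alpha> k) \<alpha>"
proof (cases meth)
  case Well
  define K where "K = real (max 1 k)"
  have "0 < K" by (simp add: K_def)
  note pos = well_argument_pos[OF assms, folded K_def]
  define f where "f x = (2 * ln (pi\<^sup>2 / 6 / \<delta>) + 4 * ln (1 + log 2 (real m / (x * K)))) / (x * K)" for x
  have "isCont f \<alpha>"
    using pos(1) \<open>0 < K\<close> assms unfolding f_def log_def by (intro continuous_intros) auto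
  moreover have "isCont h_inv (f \<alpha>)" using pos(2) unfolding f_def by (rule isCont_h_inv)
  ultimately have "isCont (\<lambda>x. h_inv (f x)) \<alpha>" by (rule isCont_o2)
  then have "isCont (\<lambda>x. x * h_inv (f x)) \<alpha>" by (intro continuous_mult continuous_ident)
  then show ?thesis unfolding Well raw_bound.simps f_def K_def .
next
  case Simes
  then show ?thesis using assms(5) by (auto intro!: continuous_intros)
next
  case DKW
  then show ?thesis unfolding raw_bound.simps by (auto intro!: continuous_intros)
next
  case KR
  have "0 < ln (1 / \<delta>)" using assms(5,6) by simp
  then have "ln (1 + ln (1 / \<delta>)) \<noteq> 0" using ln_gt_zero[of "1 + ln (1 / \<delta>)"] by linarith
  then show ?thesis using KR unfolding raw_bound.simps by (auto intro!: continuous_intros)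
qed

text \<open>Just to the right of \<open>\<alpha>\<close> the count is constant and the bound, at
  that fixed count, is continuous. A failure at \<open>\<alpha>\<close> therefore persists at a
  nearby larger rational level.\<close>

lemma BH_covered_iff_rational:
  assumes "0 < m" "0 < \<delta>" "\<delta> < 1"
  shows "(\<forall>\<alpha>\<in>{0<..<1}. BH_covered meth m H0 \<delta> \<alpha> p) \<longleftrightarrow> (\<forall>\<alpha>\<in>{0<..<1} \<inter> \<rat>. BH_covered meth m H0 \<delta> \<alpha> p)"
proof (intro iffI ballI)
  fix \<alpha> :: real assume cov: "\<forall>\<alpha>\<in>{0<..<1} \<inter> \<rat>. BH_covered meth m H0 \<delta> \<alpha> p" and \<alpha>: "\<alpha> \<in> {0<..<1}"
  define k where "k = BH_count m \<alpha> p"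
  define F where "F = FDP H0 (rejection_set m p k)"
  obtain \<beta> where \<beta>: "\<alpha> < \<beta>" "\<forall>\<alpha>'\<in>{\<alpha>..<\<beta>}. BH_count m \<alpha>' p = k"
    using BH_count_right_constant[of \<alpha> m p] by (auto simp: k_def)
  show "BH_covered meth m H0 \<delta> \<alpha> p"
  proof (rule ccontr)
    assume "\<not> BH_covered meth m H0 \<delta> \<alpha> p"
    then have *: "FDP_bound meth m \<delta> \<alpha> k < F" by (simp add: BH_covered_def k_def F_def)
    have "k \<le> m" by (simp add: k_def BH_count_le)
    then have "isCont (\<lambda>\<alpha>. FDP_bound meth m \<delta> \<alpha> k) \<alpha>"
      unfolding FDP_bound_def using isCont_raw_bound[of m k \<alpha> \<delta> meth] assms \<alpha> by (intro continuous_intros) auto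
    then have "((\<lambda>\<alpha>. FDP_bound meth m \<delta> \<alpha> k) \<longlongrightarrow> FDP_bound meth m \<delta> \<alpha> k) (at_right \<alpha>)"
      by (auto simp: isCont_def intro: filterlim_mono at_le)
    from order_tendstoD(2)[OF this *] obtain \<gamma> where \<gamma>: "\<alpha> < \<gamma>"
      "\<And>x. \<alpha> < x \<Longrightarrow> x < \<gamma> \<Longrightarrow> FDP_bound meth m \<delta> x k < F"
      by (auto simp: eventually_at_right_field)
    obtain x where x: "x \<in> \<rat>" "\<alpha> < x" "x < min (min \<beta> \<gamma>) 1"
      using Rats_dense_in_real[of \<alpha> "min (min \<beta> \<gamma>) 1"] \<beta>(1) \<gamma>(1) \<alpha> by auto
    then have "BH_covered meth m H0 \<delta> x p" using cov \<alpha> by auto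
    moreover have "BH_count m x p = k" using \<beta>(2) x by auto
    ultimately show False using \<gamma>(2)[of x] x by (simp add: BH_covered_def F_def)
  qed
qed auto

lemma measurable_ordered_pvalue:
  assumes "\<And>i. i \<in> {1..m} \<Longrightarrow> p i \<in> borel_measurable M" "k \<in> {1..m}"
  shows "(\<lambda>\<omega>. ordered_pvalue m (\<lambda>i. p i \<omega>) k) \<in> borel_measurable M"
  unfolding borel_measurable_iff_le ordered_pvalue_le_iff[OF assms(2)]
proof
  fix c
  have "Measurable.pred M (\<lambda>\<omega>. k \<le> card {i \<in> {1..m}. p i \<omega> \<le> c})"
    by (rule pred_card_le[OF finite_atLeastAtMost assms(1) borel_measurable_const])
  then show "{\<omega> \<in> space M. k \<le> card {i \<in> {1..m}. p i \<omega> \<le> c}} \<in> sets M" by (rule predE)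
qed

text \<open>Splits by the value of the count, which takes finitely many values. The level is a
  random variable so that fixed and data-dependent choices are treated together.\<close>

lemma measurable_BH_covered:
  assumes p: "\<And>i. i \<in> {1..m} \<Longrightarrow> p i \<in> borel_measurable M"
    and \<alpha>: "\<alpha> \<in> borel_measurable M" "\<And>\<omega>. \<omega> \<in> space M \<Longrightarrow> \<alpha> \<omega> \<in> {0<..<1}"
    and "H0 \<subseteq> {1..m}" "0 < m" "0 < \<delta>" "\<delta> < 1"
  shows "{\<omega> \<in> space M. BH_covered meth m H0 \<delta> (\<alpha> \<omega>) (\<lambda>i. p i \<omega>)} \<in> sets M"
proof -
  note [measurable] = \<alpha>(1)
  define q where "q k \<omega> = ordered_pvalue m (\<lambda>i. p i \<omega>) k" for k \<omega>
  have q: "q k \<in> borel_measurable M" if "k \<in> {1..m}" for k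
    unfolding q_def using p that by (rule measurable_ordered_pvalue)
  have count: "Measurable.pred M (\<lambda>\<omega>. BH_count m (\<alpha> \<omega>) (\<lambda>i. p i \<omega>) = k)" if "k \<le> m" for k
  proof -
    have le: "Measurable.pred M (\<lambda>\<omega>. 0 < k \<longrightarrow> real m * q k \<omega> / real k \<le> \<alpha> \<omega>)"
    proof (cases "k = 0")
      case False
      then have [measurable]: "q k \<in> borel_measurable M" using that by (intro q) auto
      show ?thesis by measurable
    qed simp
    have gt: "Measurable.pred M (\<lambda>\<omega>. \<alpha> \<omega> < real m * q l \<omega> / real l)" if "l \<in> {Suc k..m}" for l
    proof -
      have [measurable]: "q l \<in> borel_measurable M" using that by (intro q) auto
      show ?thesis by measurable
    qed
    have "Measurable.pred M (\<lambda>\<omega>. \<forall>l\<in>{Suc k..m}. \<alpha> \<omega> < real m * q l \<omega> / real l)"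
      using gt by (intro pred_intros_finite(3)) auto
    with le have "Measurable.pred M (\<lambda>\<omega>. (0 < k \<longrightarrow> real m * q k \<omega> / real k \<le> \<alpha> \<omega>) \<and>
        (\<forall>l\<in>{Suc k..m}. \<alpha> \<omega> < real m * q l \<omega> / real l))"
      by (rule pred_intros_logic(3))
    then show ?thesis
      using that by (simp only: BH_count_eq_iff q_def simp_thms)
  qed
  have FDP: "(\<lambda>\<omega>. FDP H0 (rejection_set m (\<lambda>i. p i \<omega>) k)) \<in> borel_measurable M" if "k \<le> m" for k
  proof (cases "k = 0")
    case False
    have eq: "rejection_set m (\<lambda>i. p i \<omega>) k = {i \<in> {1..m}. p i \<omega> \<le> q k \<omega>}"
      "rejection_set m (\<lambda>i. p i \<omega>) k \<inter> H0 = {i \<in> H0. p i \<omega> \<le> q k \<omega>}" for \<omega>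
      using False \<open>H0 \<subseteq> {1..m}\<close> by (auto simp: rejection_set_def q_def)
    have card: "(\<lambda>\<omega>. g (card {i \<in> S. p i \<omega> \<le> q k \<omega>})) \<in> borel_measurable M"
      if "S \<subseteq> {1..m}" for S and g :: "nat \<Rightarrow> real"
    proof (rule measurable_compose[where g = g])
      show "(\<lambda>\<omega>. card {i \<in> S. p i \<omega> \<le> q k \<omega>}) \<in> measurable M (count_space UNIV)"
        using that p q[of k] \<open>k \<le> m\<close> False finite_subset[OF that] by (intro measurable_card_le) auto
    qed simp
    show ?thesis
      unfolding FDP_def eq(2) unfolding eq(1)
      using card[OF \<open>H0 \<subseteq> {1..m}\<close>, of real] card[OF subset_refl, of "\<lambda>n. real (max n 1)"]
      by (rule borel_measurable_divide)
  qed (simp add: rejection_set_def)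
  have bound: "(\<lambda>\<omega>. FDP_bound meth m \<delta> (\<alpha> \<omega>) k) \<in> borel_measurable M" if "k \<le> m" for k
  proof -
    \<comment> \<open>Continuity is available only on the open unit interval, so measurability is
      composed through the restricted Borel space.\<close>
    have "continuous_on {0<..<1} (\<lambda>x. raw_bound meth m \<delta> x k)"
      using isCont_raw_bound[of m k _ \<delta> meth] assms(5-7) that
      by (intro continuous_at_imp_continuous_on) auto
    then have "(\<lambda>x. raw_bound meth m \<delta> x k) \<in> borel_measurable (restrict_space borel {0<..<1})"
      by (rule borel_measurable_continuous_on_restrict)
    moreover have "\<alpha> \<in> measurable M (restrict_space borel {0<..<1})"
      using \<alpha> by (intro measurable_restrict_space2) auto
    ultimately have [measurable]: "(\<lambda>\<omega>. raw_bound meth m \<delta> (\<alpha> \<omega>) k) \<in> borel_measurable M"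
      by (rule measurable_compose[rotated])
    show ?thesis unfolding FDP_bound_def by measurable
  qed
  have "Measurable.pred M (\<lambda>\<omega>. \<exists>k\<in>{..m}. BH_count m (\<alpha> \<omega>) (\<lambda>i. p i \<omega>) = k \<and>
      FDP H0 (rejection_set m (\<lambda>i. p i \<omega>) k) \<le> FDP_bound meth m \<delta> (\<alpha> \<omega>) k)"
  proof (intro pred_intros_finite pred_intros_logic count)
    fix k assume "k \<in> {..m}"
    then have [measurable]: "(\<lambda>\<omega>. FDP H0 (rejection_set m (\<lambda>i. p i \<omega>) k)) \<in> borel_measurable M"
      "(\<lambda>\<omega>. FDP_bound meth m \<delta> (\<alpha> \<omega>) k) \<in> borel_measurable M"
      using FDP bound by auto
    show "Measurable.pred M (\<lambda>\<omega>. FDP H0 (rejection_set m (\<lambda>i. p i \<omega>) k) \<le> FDP_bound meth m \<delta> (\<alpha> \<omega>) k)"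
      by measurable
  qed auto
  then show ?thesis
    by (simp add: BH_covered_def BH_count_le)
qed

section \<open>From null counts to coverage\<close>

primrec null_count_bound :: "bound_method \<Rightarrow> real \<Rightarrow> real \<Rightarrow> real \<Rightarrow> real" where
  "null_count_bound Simes m \<delta> t = m / \<delta> * t"
| "null_count_bound DKW m \<delta> t = sqrt (m * (1 / 2 * ln (1 / \<delta>))) + m * t"
| "null_count_bound KR m \<delta> t = ln (1 / \<delta>) / ln (1 + ln (1 / \<delta>)) + ln (1 / \<delta>) / ln (1 + ln (1 / \<delta>)) * m * t"
| "null_count_bound Well m \<delta> t = h_inv ((2 * ln (pi\<^sup>2 / 6 / \<delta>) + 4 * ln (1 + log 2 (1 / t))) / (m * t)) * m * t"

text \<open>The change of variable \<open>t = \<alpha> * k / m\<close> shows that each envelope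
  curve, divided by the number of rejections, is the corresponding bound.\<close>

lemma raw_bound_eq:
  assumes "0 < k" "0 < m" "0 < \<alpha>"
  shows "raw_bound meth m \<delta> \<alpha> k = null_count_bound meth (real m) \<delta> (\<alpha> * real k / real m) / real k"
proof -
  have max: "max 1 k = k" using assms by auto
  show ?thesis
  proof (cases meth)
    case Simes
    then show ?thesis using assms by simp
  next
    case DKW
    define c where "c = sqrt (real m) * sqrt (1 / 2 * ln (1 / \<delta>))"
    show ?thesis
      unfolding DKW raw_bound.simps null_count_bound.simps real_sqrt_mult max c_def[symmetric]
      using assms by (simp add: field_simps)
  next
    case KR
    define c where "c = ln (1 / \<delta>) / ln (1 + ln (1 / \<delta>))"
    show ?thesis
      unfolding KR raw_bound.simps null_count_bound.simps max c_def[symmetric]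
      using assms by (simp add: field_simps)
  next
    case Well
    define t where "t = \<alpha> * real k / real m"
    have t: "real m / (\<alpha> * real k) = 1 / t" "\<alpha> * real k = real m * t" "\<alpha> = t * real m / real k"
      using assms by (auto simp: t_def)
    define c where "c = h_inv ((2 * ln (pi\<^sup>2 / 6 / \<delta>) + 4 * ln (1 + log 2 (1 / t))) / (real m * t))"
    show ?thesis
      unfolding Well raw_bound.simps null_count_bound.simps max t_def[symmetric] t(1,2) c_def[symmetric]
      by (simp add: t(3))
  qed
qed

text \<open>The deterministic half. With \<open>k > 0\<close> rejections the envelope is used only
  at \<open>t = \<alpha> * k / m\<close>, but this point depends on the data and on the level, hence
  the demand for all \<open>t\<close>.\<close>

lemma BH_covered_if_null_count_le:
  assumes "H0 \<subseteq> {1..m}" "0 < m" "0 < \<delta>" "\<delta> < 1" "0 < \<alpha>" "\<alpha> < 1"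
    and count: "\<And>t. 0 < t \<Longrightarrow> t \<le> 1 \<Longrightarrow> real (card {i \<in> H0. p i \<le> t}) \<le> null_count_bound meth (real m) \<delta> t"
  shows "BH_covered meth m H0 \<delta> \<alpha> p"
proof (cases "BH_count m \<alpha> p = 0")
  case True
  then show ?thesis
    using raw_bound_nonneg[of m 0 \<alpha> \<delta> meth] assms
    by (simp add: BH_covered_def FDP_bound_def FDP_def rejection_set_def)
next
  case False
  define k where "k = BH_count m \<alpha> p"
  define t where "t = \<alpha> * real k / real m"
  have k: "0 < k" "k \<le> m" using False by (auto simp: k_def BH_count_le)
  have "\<alpha> * real k \<le> 1 * real m" using k assms by (intro mult_mono) auto
  then have t: "0 < t" "t \<le> 1" using k assms by (auto simp: t_def)
  have "FDP H0 (rejection_set m p k) \<le> real (card {i \<in> H0. p i \<le> t}) / real k"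
    unfolding t_def using k by (intro FDP_BH_le assms) (auto simp: k_def)
  also have "\<dots> \<le> null_count_bound meth (real m) \<delta> t / real k"
    using count[OF t] by (intro divide_right_mono) auto
  also have "\<dots> = raw_bound meth m \<delta> \<alpha> k"
    unfolding t_def using k assms by (intro raw_bound_eq[symmetric]) auto
  finally show ?thesis
    using k FDP_le_1[of H0 m p k] by (simp add: BH_covered_def FDP_bound_def k_def[symmetric])
qed

lemma (in uniform_sample) null_count_envelope:
  assumes "real (card H) \<le> m" "0 < m" "0 < \<delta>" "\<delta> < 1"
  shows "envelope 0 (null_count_bound meth m \<delta>) \<delta>"
proof (cases meth)
  case Simes
  then have "null_count_bound meth m \<delta> = (\<lambda>t. m / \<delta> * t)" by (simp add: fun_eq_iff)
  then show ?thesis by (simp only: simes_event[OF assms(1-3)])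
next
  case DKW
  then have "null_count_bound meth m \<delta> = (\<lambda>t. sqrt (m * (1 / 2 * ln (1 / \<delta>))) + m * t)" by (simp add: fun_eq_iff)
  then show ?thesis by (simp only: dkw_event[OF assms])
next
  case KR
  then have "null_count_bound meth m \<delta> = (\<lambda>t. ln (1 / \<delta>) / ln (1 + ln (1 / \<delta>)) + ln (1 / \<delta>) / ln (1 + ln (1 / \<delta>)) * m * t)" by (simp add: fun_eq_iff)
  then show ?thesis by (simp only: kr_event[OF assms])
next
  case Well
  then have "null_count_bound meth m \<delta> = (\<lambda>t. h_inv ((2 * ln (pi\<^sup>2 / 6 / \<delta>) + 4 * ln (1 + log 2 (1 / t))) / (m * t)) * m * t)" by (simp add: fun_eq_iff)
  then show ?thesis by (simp only: wellner_event[OF assms])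
qed

theorem corollary9:
  fixes M :: "'a measure" and p :: "nat \<Rightarrow> 'a \<Rightarrow> real"
    and m :: nat and H0 :: "nat set" and \<delta> :: real and meth :: bound_method
  assumes "prob_space M"
    and "prob_space.indep_vars M (\<lambda>_. borel) p {1..m}"
    and "\<And>i \<omega>. i \<in> {1..m} \<Longrightarrow> \<omega> \<in> space M \<Longrightarrow> p i \<omega> \<in> {0..1}"
    and "H0 \<subseteq> {1..m}" and "0 < card H0" and "card H0 < m"
    and "\<And>i. i \<in> H0 \<Longrightarrow> distr M borel (p i) = uniform_measure lborel {0..1}"
    and "0 < \<delta>" and "\<delta> < 1"
    and "meth = KR \<Longrightarrow> \<delta> \<le> 31 / 100"
  shows "(\<forall>\<alpha>\<in>{0<..<1}.
            measure M {\<omega> \<in> space M. BH_covered meth m H0 \<delta> \<alpha> (\<lambda>i. p i \<omega>)} \<ge> 1 - \<delta>) \<and>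
         measure M {\<omega> \<in> space M. \<forall>\<alpha>\<in>{0<..<1}. BH_covered meth m H0 \<delta> \<alpha> (\<lambda>i. p i \<omega>)} \<ge> 1 - \<delta> \<and>
         (\<forall>\<alpha>' \<in> borel_measurable M. (\<forall>\<omega>\<in>space M. \<alpha>' \<omega> \<in> {0<..<1}) \<longrightarrow>
            measure M {\<omega> \<in> space M. BH_covered meth m H0 \<delta> (\<alpha>' \<omega>) (\<lambda>i. p i \<omega>)} \<ge> 1 - \<delta>)"
proof -
  interpret prob_space M by fact
  have "0 < m" using assms(6) by simp
  have p: "p i \<in> borel_measurable M" if "i \<in> {1..m}" for i
    using assms(2) that unfolding indep_vars_def by auto
  interpret uniform_sample M H0 p
  proof
    show "finite H0" using assms(4) finite_subset by blast
    show "indep_vars (\<lambda>_. borel) p H0" using assms(2,4) by (rule indep_vars_subset)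
    show "distr M borel (p i) = uniform_measure lborel {0..1}" if "i \<in> H0" for i
      using that by (rule assms(7))
    show "p i \<omega> \<in> {0..1}" if "i \<in> H0" "\<omega> \<in> space M" for i \<omega>
      using that assms(4) by (intro assms(3)) auto
  qed
  have "envelope 0 (null_count_bound meth (real m) \<delta>) \<delta>"
    using \<open>0 < m\<close> assms(6,8,9) by (intro null_count_envelope) auto
  then obtain E where E: "E \<in> events" "prob E \<le> \<delta>"
    and N_le: "\<And>\<omega> t. \<omega> \<in> space M - E \<Longrightarrow> 0 < t \<Longrightarrow> t \<le> 1 \<Longrightarrow> N t \<omega> \<le> null_count_bound meth (real m) \<delta> t"
    unfolding envelope_def by (meson less_imp_le)
  \<comment> \<open>The exceptional event \<open>E\<close> was fixed before the level, so outside it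
    the level may depend on the outcome; all three claims follow from this one inclusion and
    measurability.\<close>
  have covered: "BH_covered meth m H0 \<delta> \<alpha> (\<lambda>i. p i \<omega>)" if "\<omega> \<in> space M - E" "\<alpha> \<in> {0<..<1}" for \<omega> \<alpha>
    using that \<open>0 < m\<close> assms(4,8,9) N_le by (intro BH_covered_if_null_count_le) auto
  have prob_ge: "1 - \<delta> \<le> prob A" if "A \<in> events" "space M - E \<subseteq> A" for A
    using finite_measure_mono[OF that(2,1)] prob_compl[OF E(1)] E(2) by linarith
  have sets: "{\<omega> \<in> space M. BH_covered meth m H0 \<delta> (\<alpha> \<omega>) (\<lambda>i. p i \<omega>)} \<in> events"
    if "\<alpha> \<in> borel_measurable M" "\<forall>\<omega>\<in>space M. \<alpha> \<omega> \<in> {0<..<1}" for \<alpha>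
    using that p \<open>0 < m\<close> assms(4,8,9) by (intro measurable_BH_covered) auto
  have sets_all: "{\<omega> \<in> space M. \<forall>\<alpha>\<in>{0<..<1}. BH_covered meth m H0 \<delta> \<alpha> (\<lambda>i. p i \<omega>)} \<in> events"
    unfolding BH_covered_iff_rational[OF \<open>0 < m\<close> assms(8,9)]
  proof (rule sets.sets_Collect_countable_All')
    show "{\<omega> \<in> space M. BH_covered meth m H0 \<delta> \<alpha> (\<lambda>i. p i \<omega>)} \<in> events" if "\<alpha> \<in> {0<..<1} \<inter> \<rat>" for \<alpha>
      using sets[of "\<lambda>_. \<alpha>"] that by simp
    show "countable ({0<..<1} \<inter> \<rat> :: real set)"
      using countable_rat by (rule countable_subset[rotated]) simp
  qed
  show ?thesis
  proof (intro conjI ballI impI)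
    show "1 - \<delta> \<le> prob {\<omega> \<in> space M. BH_covered meth m H0 \<delta> \<alpha> (\<lambda>i. p i \<omega>)}" if "\<alpha> \<in> {0<..<1}" for \<alpha>
      using that covered by (intro prob_ge sets[of "\<lambda>_. \<alpha>"]) auto
    show "1 - \<delta> \<le> prob {\<omega> \<in> space M. \<forall>\<alpha>\<in>{0<..<1}. BH_covered meth m H0 \<delta> \<alpha> (\<lambda>i. p i \<omega>)}"
      using covered by (intro prob_ge sets_all) auto
    show "1 - \<delta> \<le> prob {\<omega> \<in> space M. BH_covered meth m H0 \<delta> (\<alpha> \<omega>) (\<lambda>i. p i \<omega>)}"
      if "\<alpha> \<in> borel_measurable M" "\<forall>\<omega>\<in>space M. \<alpha> \<omega> \<in> {0<..<1}" for \<alpha>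
      using that covered by (intro prob_ge sets) auto
  qed
qed

end
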